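(* Let $G$ be a finite group and let $X$ be a separable real Banach space such that $\dim X\geq |G|$. Then the group $\{-1,1\}\times G$ is representable in $X$.
   Context: A group $H$ is representable in a Banach space $X$ if there exists an equivalent norm on $X$ for which the group of isometries on $X$ (all surjective linear isometries of $X$ onto itself) is isomorphic, as a group, to $H$. Here $\{-1,1\}$ is the multiplicative group with two elements. *)

theory Defs
  imports "HOL-Analysis.Analysis" "HOL-Algebra.Sym_Groups" "HOL-Library.Extended_Nat"
begin

text \<open>Since \<^const>\<open>dim\<close> is \<open>0\<close> on spaces without a finite basis, infinite dimension is
  recorded separately.\<close>

definition space_dim :: "'a::real_vector itself \<Rightarrow> enat" where
  "space_dim _ =
    (if \<exists>B::'a set. finite B \<and> span B = UNIV then enat (dim (UNIV :: 'a set)) else \<infinity>)"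

definition is_norm :: "('a::real_vector \<Rightarrow> real) \<Rightarrow> bool" where
  "is_norm N \<longleftrightarrow>
    (\<forall>x. N x = 0 \<longleftrightarrow> x = 0) \<and>
    (\<forall>x y. N (x + y) \<le> N x + N y) \<and>
    (\<forall>c x. N (c *\<^sub>R x) = \<bar>c\<bar> * N x)"

definition equivalent_norm :: "('a::real_normed_vector \<Rightarrow> real) \<Rightarrow> bool" where
  "equivalent_norm N \<longleftrightarrow>
    is_norm N \<and> (\<exists>c>0. \<exists>C>0. \<forall>x. c * norm x \<le> N x \<and> N x \<le> C * norm x)"

definition isometry_group :: "('a::real_vector \<Rightarrow> real) \<Rightarrow> ('a \<Rightarrow> 'a) monoid" where
  "isometry_group N =
    \<lparr>carrier = {T. linear T \<and> surj T \<and> (\<forall>x. N (T x) = N x)}, mult = (\<circ>), one = id\<rparr>"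

definition representable_in ::
    "('g, 'm) monoid_scheme \<Rightarrow> 'a::real_normed_vector itself \<Rightarrow> bool" where
  "representable_in H _ \<longleftrightarrow>
    (\<exists>N :: 'a \<Rightarrow> real. equivalent_norm N \<and> isometry_group N \<cong> H)"

lemma group_isometry_group:
  assumes "is_norm N"
  shows "group (isometry_group N)"
proof (rule groupI)
  fix T assume T: "T \<in> carrier (isometry_group N)"
  then have lin: "linear T" and surj: "surj T" and iso: "\<And>x. N (T x) = N x"
    by (auto simp: isometry_group_def)
  have inj: "inj T"
    using assms iso by (metis is_norm_def lin linear_injective_0)
  obtain S where S: "linear S" "S \<circ> T = id"
    using linear_injective_left_inverse[OF lin inj] by blast
  then have ST: "S (T x) = x" for x
    by (metis comp_apply id_apply)
  have "surj S"
    using ST by (metis surjI)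
  moreover have "N (S y) = N y" for y
    using surj ST iso by (metis surjD)
  ultimately show "\<exists>S\<in>carrier (isometry_group N).
      S \<otimes>\<^bsub>isometry_group N\<^esub> T = \<one>\<^bsub>isometry_group N\<^esub>"
    using S by (auto simp: isometry_group_def)
next
  fix S T assume "S \<in> carrier (isometry_group N)" "T \<in> carrier (isometry_group N)"
  then show "S \<otimes>\<^bsub>isometry_group N\<^esub> T \<in> carrier (isometry_group N)"
    by (simp add: isometry_group_def linear_compose comp_surj del: o_apply) simp
qed (auto simp: isometry_group_def comp_assoc linear_id[unfolded id_def] id_def)

end

theory Submission
  imports Defs
begin

text \<open>Let \<open>n = |G|\<close>. Since \<open>X\<close> has dimension at least \<open>n\<close>, it splits as \<open>\<real>\<^sup>G \<oplus> Y\<close>, and \<open>G\<close> acts on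
\<open>X\<close> by the regular representation on the first summand and trivially on the second. The norm that is
constructed has the form
\<open>N x = M x + (\<Sum>f \<bar>f x\<bar>)\<close>, where \<open>M\<close> is an equivalent \<open>G\<close>-invariant norm that is Gateaux differentiable
away from the origin and \<open>f\<close> runs through a countable \<open>G\<close>-invariant set of functionals that are pairwise
non-proportional. Then \<open>N\<close> is \<open>G\<close>-invariant, and everything rests on the fact that the set of
functionals can be read off from the places where \<open>N\<close> fails to be differentiable.

The second difference quotient of \<open>N\<close> at \<open>x\<close> in direction \<open>v\<close> tends to the sum of \<open>2 * \<bar>f v\<bar>\<close> over the
functionals with \<open>f x = 0\<close> (\<open>kinked_second_difference\<close>). By the Baire category theorem the kernel of
each \<open>f\<close> contains a non-zero point at which no other functional of the set vanishes, so there the limit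
is \<open>2 * \<bar>f v\<bar>\<close>; only if \<open>X\<close> is a line is there no such point, and then \<open>T\<close> is a sign anyway. A linear isometry \<open>T\<close> carries second differences to second differences; hence composition
with \<open>T\<close> permutes the functionals up to sign (\<open>kink_functional_transport\<close>).

It remains to choose the functionals so that only the maps \<open>x \<mapsto> \<plusminus>g x\<close> can do this. Two devices
are used. First, functionals in different \<open>G\<close>-orbits are scaled to have dual norms of very different
size; \<open>T\<close> preserves dual norms, so it preserves every orbit up to sign
(\<open>orbit_preserving_renorming\<close>). Second, the orbits are linked by linear relations. Let \<open>u\<^sub>g\<close> be the
coordinates on \<open>\<real>\<^sup>G\<close> and let \<open>y\<^sub>k\<close> be functionals that vanish on \<open>\<real>\<^sup>G\<close> and separate the points of \<open>Y\<close>.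
The orbits are those of \<open>u\<^sub>1\<close>, of \<open>L = (\<Sum>h. c\<^sub>h u\<^sub>h)\<close> with distinct positive weights \<open>c\<^sub>h\<close>
(for non-trivial \<open>G\<close>), of each \<open>y\<^sub>k\<close> and of each \<open>u\<^sub>1 + y\<^sub>k\<close>. After composing \<open>T\<close> with some \<open>\<plusminus>g\<close>, it fixes \<open>L\<close>; since \<open>T\<close>
permutes the \<open>u\<^sub>h\<close> up to sign and the weights are distinct and positive, it fixes each \<open>u\<^sub>h\<close>; then the
orbit of \<open>u\<^sub>1 + y\<^sub>k\<close> forces the sign of \<open>y\<^sub>k\<close>, so that \<open>T\<close> is the identity
(\<open>preserving_linear_maps\<close>).

The square of a smooth norm is obtained as the infimal convolution of the square of the given norm
with the square of a Hilbertian norm on a dense subspace, which is where separability enters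
(\<open>smooth_equivalent_norm\<close>); summing its translates under \<open>G\<close> gives \<open>M\<close>. Separability also yields a countable separating set of functionals, by a Hahn--Banach argument
(\<open>norming_functional\<close>).\<close>

section \<open>Norming functionals\<close>

definition sublinear :: "('a::real_vector \<Rightarrow> real) \<Rightarrow> bool" where
  "sublinear p \<longleftrightarrow> (\<forall>x y. p (x + y) \<le> p x + p y) \<and> (\<forall>c>0. \<forall>x. p (c *\<^sub>R x) \<le> c * p x)"

lemma sublinear_add: "sublinear p \<Longrightarrow> p (x + y) \<le> p x + p y"
  by (simp add: sublinear_def)

lemma sublinear_scale:
  assumes "sublinear p" "c \<ge> 0" shows "p (c *\<^sub>R x) = c * p x"
proof (cases "c = 0")
  case True
  have "p (2 *\<^sub>R 0) \<le> 2 * p 0" "p ((1/2) *\<^sub>R 0) \<le> (1/2) * p 0"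
    using assms(1) zero_less_numeral half_gt_zero[OF zero_less_one] unfolding sublinear_def by blast+
  then show ?thesis using True by simp
next
  case False
  then have c: "c > 0" using assms by simp
  have "p ((1/c) *\<^sub>R (c *\<^sub>R x)) \<le> (1/c) * p (c *\<^sub>R x)"
    using assms(1) c unfolding sublinear_def by (meson divide_pos_pos zero_less_one)
  then have "c * p x \<le> p (c *\<^sub>R x)"
    using c by (simp add: field_simps)
  then show ?thesis using assms(1) c by (simp add: sublinear_def order_antisym)
qed

lemma sublinear_zero: "sublinear p \<Longrightarrow> p 0 = 0"
  using sublinear_scale[of p 0 0] by simp

lemma sublinear_lower: "sublinear p \<Longrightarrow> - p (- x) \<le> p x"
  using sublinear_add[of p x "-x"] sublinear_zero[of p] by simp

lemma sublinear_norm: "sublinear (norm :: 'a::real_normed_vector \<Rightarrow> real)"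
  by (simp add: sublinear_def norm_triangle_ineq)

text \<open>Tilting \<open>q\<close> along the ray through \<open>y\<close> gives a smaller sublinear functional, whose value at \<open>-y\<close> is at
most \<open>-q y\<close>. A sublinear functional that is minimal therefore equals its tilt along every \<open>y\<close>, which
makes it additive.\<close>

lemma sublinear_tilt:
  assumes q: "sublinear q"
  shows "\<exists>r. sublinear r \<and> (\<forall>x. r x \<le> q x) \<and> (\<forall>x. r x \<le> q (x + y) - q y)"
proof -
  define r where "r x = (INF t\<in>{0..}. q (x + t *\<^sub>R y) - t * q y)" for x
  have low: "- q (- x) \<le> q (x + t *\<^sub>R y) - t * q y" if "t \<ge> 0" for x t
    using sublinear_add[OF q, of "x + t *\<^sub>R y" "-x"] sublinear_scale[OF q that, of y] by simp
  have bdd: "bdd_below ((\<lambda>t. q (x + t *\<^sub>R y) - t * q y) ` {0..})" for x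
    by (rule bdd_belowI2[of _ "- q (- x)"]) (use low in auto)
  have le: "r x \<le> q (x + t *\<^sub>R y) - t * q y" if "t \<ge> 0" for x t
    unfolding r_def by (rule cINF_lower[OF bdd]) (use that in auto)
  have ge: "b \<le> r x" if "\<And>t. t \<ge> 0 \<Longrightarrow> b \<le> q (x + t *\<^sub>R y) - t * q y" for b x
    unfolding r_def by (rule cINF_greatest) (use that in auto)
  have "r (x + x') \<le> r x + r x'" for x x'
  proof -
    have *: "r (x + x') - (q (x' + t' *\<^sub>R y) - t' * q y) \<le> q (x + t *\<^sub>R y) - t * q y"
      if "t \<ge> 0" "t' \<ge> 0" for t t'
      using le[of "t + t'" "x + x'"] sublinear_add[OF q, of "x + t *\<^sub>R y" "x' + t' *\<^sub>R y"] that
      by (simp add: algebra_simps)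
    have "r (x + x') - (q (x' + t' *\<^sub>R y) - t' * q y) \<le> r x" if "t' \<ge> 0" for t'
      by (rule ge) (use * that in auto)
    then have "r (x + x') - r x \<le> r x'"
      by (intro ge) (simp add: algebra_simps)
    then show ?thesis by simp
  qed
  moreover have "r (c *\<^sub>R x) \<le> c * r x" if "c > 0" for c x
  proof -
    have "r (c *\<^sub>R x) / c \<le> r x"
    proof (rule ge)
      fix t :: real assume "t \<ge> 0"
      then have "r (c *\<^sub>R x) \<le> q (c *\<^sub>R x + (c * t) *\<^sub>R y) - (c * t) * q y"
        using that by (intro le) simp
      also have "q (c *\<^sub>R x + (c * t) *\<^sub>R y) = c * q (x + t *\<^sub>R y)"
        using sublinear_scale[OF q, of c "x + t *\<^sub>R y"] that by (simp add: scaleR_add_right)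
      finally show "r (c *\<^sub>R x) / c \<le> q (x + t *\<^sub>R y) - t * q y"
        using that by (simp add: field_simps)
    qed
    then show ?thesis using that by (simp add: field_simps)
  qed
  ultimately have "sublinear r" by (simp add: sublinear_def)
  then show ?thesis using le[of 0] le[of 1] by (intro exI[of _ r]) simp
qed

text \<open>A minimal element among the sublinear functionals below \<open>p\<close>, which exists by Zorn's lemma, is linear
by \<open>sublinear_tilt\<close>.\<close>

lemma linear_minorant:
  fixes p :: "'a::real_vector \<Rightarrow> real"
  assumes p: "sublinear p"
  shows "\<exists>f. linear f \<and> (\<forall>x. f x \<le> p x)"
proof -
  define A where "A = {q. sublinear q \<and> (\<forall>x. q x \<le> p x)}"
  have "\<exists>m\<in>A. \<forall>q\<in>A. (\<forall>x. q x \<le> m x) \<longrightarrow> q = m"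
  proof (rule predicate_Zorn[where P = "\<lambda>a b. \<forall>x. b x \<le> a x"])
    show "partial_order_on A (relation_of (\<lambda>a b. \<forall>x. b x \<le> a x) A)"
      by (rule partial_order_on_relation_ofI) (auto simp: fun_eq_iff intro: order_trans order_antisym)
  next
    fix C assume "C \<in> Chains (relation_of (\<lambda>a b. \<forall>x. b x \<le> a x) A)"
    then have CA: "C \<subseteq> A"
      and ch: "\<And>q r. q \<in> C \<Longrightarrow> r \<in> C \<Longrightarrow> (\<forall>x. r x \<le> q x) \<or> (\<forall>x. q x \<le> r x)"
      by (auto simp: Chains_def relation_of_def)
    show "\<exists>u\<in>A. \<forall>a\<in>C. \<forall>x. u x \<le> a x"
    proof (cases "C = {}")
      case True
      then show ?thesis using p by (auto simp: A_def)
    next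
      case False
      define u where "u x = (INF q\<in>C. q x)" for x
      have sub: "sublinear q" and qp: "q x \<le> p x" if "q \<in> C" for q x
        using CA that by (auto simp: A_def)
      have "bdd_below ((\<lambda>q. q x) ` C)" for x
      proof (rule bdd_belowI2)
        fix q assume "q \<in> C"
        then show "- p (- x) \<le> q x"
          using sublinear_lower[OF sub, of q x] qp[of q "-x"] by linarith
      qed
      then have le: "u x \<le> q x" if "q \<in> C" for q x
        unfolding u_def by (rule cINF_lower) (use that in auto)
      have ge: "b \<le> u x" if "\<And>q. q \<in> C \<Longrightarrow> b \<le> q x" for b x
        unfolding u_def by (rule cINF_greatest) (use that False in auto)
      have "u (x + y) \<le> u x + u y" for x y
      proof -
        have *: "u (x + y) - r y \<le> q x" if qr: "q \<in> C" "r \<in> C" for q r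
        proof -
          obtain s where "s \<in> C" "s x \<le> q x" "s y \<le> r y"
            using ch[OF qr] qr by blast
          then show ?thesis using le[of s "x + y"] sublinear_add[OF sub, of s x y] by simp
        qed
        have "u (x + y) - r y \<le> u x" if "r \<in> C" for r
          by (rule ge) (use * that in auto)
        then have "u (x + y) - u x \<le> u y"
          by (intro ge) (simp add: algebra_simps)
        then show ?thesis by simp
      qed
      moreover have "u (c *\<^sub>R x) \<le> c * u x" if "c > 0" for c x
      proof -
        have "u (c *\<^sub>R x) / c \<le> u x"
        proof (rule ge)
          fix q assume "q \<in> C"
          then show "u (c *\<^sub>R x) / c \<le> q x"
            using le[of q "c *\<^sub>R x"] sublinear_scale[OF sub, of q c x] that
            by (simp add: field_simps)
        qed
        then show ?thesis using that by (simp add: field_simps)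
      qed
      ultimately have "sublinear u" by (simp add: sublinear_def)
      moreover obtain q where q: "q \<in> C" using False by blast
      have "u x \<le> p x" for x using le[OF q, of x] qp[OF q, of x] by simp
      ultimately have "u \<in> A" by (simp add: A_def)
      then show ?thesis using le by auto
    qed
  qed
  then obtain m where m: "m \<in> A" and min: "\<And>q. q \<in> A \<Longrightarrow> (\<And>x. q x \<le> m x) \<Longrightarrow> q = m"
    by blast
  have sub: "sublinear m" and mp: "\<And>x. m x \<le> p x" using m by (auto simp: A_def)
  have add: "m (x + y) = m x + m y" for x y
  proof -
    obtain r where r: "sublinear r" "\<And>x. r x \<le> m x" "\<And>x. r x \<le> m (x + y) - m y"
      using sublinear_tilt[OF sub, of y] by blast
    then have "r \<in> A" using mp by (auto simp: A_def intro: order_trans)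
    then have "r = m" using r by (intro min)
    then show ?thesis using r(3)[of x] sublinear_add[OF sub, of x y] by simp
  qed
  have neg: "m (- x) = - m x" for x
    using add[of x "-x"] sublinear_zero[OF sub] by simp
  have "m (c *\<^sub>R x) = c *\<^sub>R m x" for c x
  proof (cases "c \<ge> 0")
    case True
    then show ?thesis using sublinear_scale[OF sub] by simp
  next
    case False
    then show ?thesis using sublinear_scale[OF sub, of "-c" x] neg[of "c *\<^sub>R x"] by simp
  qed
  then have "linear m" using add by (intro linearI)
  then show ?thesis using mp by blast
qed

text \<open>Tilting the norm along \<open>x\<close> before passing to a linear minorant pushes the value at \<open>-x\<close> down to
\<open>-norm x\<close>, so the minorant attains its norm at \<open>x\<close>.\<close>

lemma norming_functional:
  fixes x :: "'a::real_normed_vector"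
  shows "\<exists>f. bounded_linear f \<and> (\<forall>y. \<bar>f y\<bar> \<le> norm y) \<and> f x = norm x"
proof -
  obtain r where r: "sublinear r" "\<And>y. r y \<le> norm y" "\<And>y. r y \<le> norm (y + x) - norm x"
    using sublinear_tilt[OF sublinear_norm, of x] by blast
  obtain f where f: "linear f" "\<And>y. f y \<le> r y"
    using linear_minorant[OF r(1)] by blast
  have neg: "f (- y) = - f y" for y by (simp add: f(1) linear_neg)
  have b: "\<bar>f y\<bar> \<le> norm y" for y
    using f(2)[of y] f(2)[of "-y"] r(2)[of y] r(2)[of "-y"] neg[of y] by simp
  moreover have "norm x \<le> f x"
    using f(2)[of "-x"] r(3)[of "-x"] neg[of x] by simp
  moreover have "bounded_linear f"
    by (rule bounded_linear_intro[of _ 1]) (use f(1) b in \<open>auto simp: linear_add linear_scale\<close>)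
  ultimately show ?thesis by (smt (verit))
qed

lemma separable_space_dense_sequence:
  assumes "separable_space (euclidean :: 'a::real_normed_vector topology)"
  shows "\<exists>d :: nat \<Rightarrow> 'a. \<forall>x. \<forall>e>0. \<exists>k. norm (d k - x) < e"
proof -
  obtain C :: "'a set" where C: "countable C" "closure C = UNIV"
    using assms by (auto simp: separable_space_def)
  then have "C \<noteq> {}" by auto
  define d where "d = from_nat_into C"
  have d: "range d = C"
    unfolding d_def using \<open>C \<noteq> {}\<close> C(1) by (rule range_from_nat_into)
  have "\<exists>k. norm (d k - x) < e" if "e > 0" for x e
  proof -
    have "x \<in> closure C" using C by simp
    then show ?thesis using d that unfolding closure_approachable by (auto simp: dist_norm)
  qed
  then show ?thesis by blast
qed

text \<open>Functionals that norm the members of a dense sequence separate points: if all of them vanish at \<open>x\<close>,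
then every \<open>d k\<close> close to \<open>x\<close> has small norm.\<close>

lemma separating_sequence:
  fixes d :: "nat \<Rightarrow> 'a::real_normed_vector"
  assumes d: "\<And>x e. e > 0 \<Longrightarrow> \<exists>k. norm (d k - x) < e"
  shows "\<exists>\<phi> :: nat \<Rightarrow> 'a \<Rightarrow> real. (\<forall>k. bounded_linear (\<phi> k)) \<and> (\<forall>x. (\<forall>k. \<phi> k x = 0) \<longrightarrow> x = 0)"
proof -
  have "\<forall>k. \<exists>f. bounded_linear f \<and> (\<forall>y. \<bar>f y\<bar> \<le> norm y) \<and> f (d k) = norm (d k)"
    using norming_functional by blast
  then obtain \<phi> :: "nat \<Rightarrow> 'a \<Rightarrow> real" where \<phi>: "\<And>k. bounded_linear (\<phi> k)"
      "\<And>k y. \<bar>\<phi> k y\<bar> \<le> norm y" "\<And>k. \<phi> k (d k) = norm (d k)"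
    by metis
  have "x = 0" if "\<And>k. \<phi> k x = 0" for x
  proof (rule ccontr)
    assume "x \<noteq> 0"
    then obtain k where k: "norm (d k - x) < norm x / 2"
      using d[of "norm x / 2" x] by auto
    have "norm (d k) = \<phi> k (d k - x)"
      using \<phi>(1,3) that by (simp add: linear_simps)
    also have "\<dots> < norm x / 2" using \<phi>(2)[of k "d k - x"] k by simp
    finally show False using k norm_triangle_ineq2[of x "d k"] by (simp add: norm_minus_commute)
  qed
  then show ?thesis using \<phi>(1) by blast
qed

section \<open>Biorthogonal systems and generic points\<close>

text \<open>Induction on \<open>A\<close>: as long as the vectors found so far do not span, some vector remains non-zero after
subtracting its components along them, and a member of the separating sequence detects it.\<close>

lemma biorthogonal_system:
  fixes \<phi> :: "nat \<Rightarrow> 'a::real_normed_vector \<Rightarrow> real"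
  assumes \<phi>: "\<And>k. bounded_linear (\<phi> k)" and sep: "\<And>x. (\<And>k. \<phi> k x = 0) \<Longrightarrow> x = 0"
    and "finite A" and "enat (card A) \<le> space_dim TYPE('a)"
  shows "\<exists>(e :: 'i \<Rightarrow> 'a) u. (\<forall>i\<in>A. bounded_linear (u i)) \<and>
           (\<forall>i\<in>A. \<forall>j\<in>A. u i (e j) = (if i = j then 1 else 0 :: real))"
  using assms(3,4)
proof (induction A rule: finite_induct)
  case empty
  then show ?case by simp
next
  case (insert a A)
  have "enat (card A) \<le> space_dim TYPE('a)"
    using insert by (simp add: order_trans[rotated])
  then obtain e :: "'i \<Rightarrow> 'a" and u where u: "\<And>i. i \<in> A \<Longrightarrow> bounded_linear (u i)"
    and ue: "\<And>i j. i \<in> A \<Longrightarrow> j \<in> A \<Longrightarrow> u i (e j) = (if i = j then 1 else 0 :: real)"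
    using insert.IH by blast
  have "span (e ` A) \<noteq> UNIV"
  proof
    assume sp: "span (e ` A) = UNIV"
    then have "space_dim TYPE('a) = enat (dim (UNIV :: 'a set))"
      using insert.hyps(1) unfolding space_dim_def by (metis finite_imageI)
    moreover have "dim (UNIV :: 'a set) \<le> card (e ` A)"
      using insert.hyps(1) sp by (intro dim_le_card) auto
    moreover have "card (e ` A) \<le> card A" using insert.hyps(1) by (rule card_image_le)
    ultimately show False using insert by simp
  qed
  then obtain x where x: "x \<notin> span (e ` A)" by blast
  define P where "P y = y - (\<Sum>i\<in>A. u i y *\<^sub>R e i)" for y
  have Pe: "P (e j) = 0" if "j \<in> A" for j
  proof -
    have "(\<Sum>i\<in>A. u i (e j) *\<^sub>R e i) = (\<Sum>i\<in>A. if i = j then e i else 0)"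
      using that by (intro sum.cong) (auto simp: ue)
    then show ?thesis using that insert.hyps(1) by (simp add: P_def)
  qed
  have uP: "u j (P y) = 0" if "j \<in> A" for j y
  proof -
    have "u j (P y) = u j y - (\<Sum>i\<in>A. u i y * u j (e i))"
      using u[OF that] by (simp add: P_def linear_simps linear_sum[OF bounded_linear.linear] linear_scale[OF bounded_linear.linear])
    also have "(\<Sum>i\<in>A. u i y * u j (e i)) = (\<Sum>i\<in>A. if i = j then u i y else 0)"
      using that by (intro sum.cong) (auto simp: ue)
    also have "\<dots> = u j y" using that insert.hyps(1) by simp
    finally show ?thesis by simp
  qed
  have blP: "bounded_linear P"
    unfolding P_def using u
    by (intro bounded_linear_sub bounded_linear_ident bounded_linear_sum
        bounded_linear_compose[OF bounded_linear_scaleR_left]) auto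
  have "(\<Sum>i\<in>A. u i x *\<^sub>R e i) \<in> span (e ` A)"
    by (intro span_sum span_scale span_base) auto
  then have "P x \<noteq> 0" using x by (auto simp: P_def)
  then obtain k where k: "\<phi> k (P x) \<noteq> 0" using sep by blast
  have PP: "P (P x) = P x"
    by (subst P_def) (simp add: uP)
  define e' where "e' = e(a := P x)"
  define u' where "u' = u(a := (\<lambda>y. \<phi> k (P y) / \<phi> k (P x)))"
  have "bounded_linear (\<lambda>y. \<phi> k (P y) / \<phi> k (P x))"
    by (intro bounded_linear_compose[OF bounded_linear_divide]
        bounded_linear_compose[OF \<phi>] blP)
  then have "\<forall>i\<in>insert a A. bounded_linear (u' i)"
    using u by (auto simp: u'_def)
  moreover have "\<forall>i\<in>insert a A. \<forall>j\<in>insert a A. u' i (e' j) = (if i = j then 1 else 0)"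
    using insert.hyps(2) ue uP Pe k PP linear_0[OF bounded_linear.linear[OF \<phi>]]
    by (auto simp: u'_def e'_def)
  ultimately show ?case by blast
qed

text \<open>A proper closed subspace is nowhere dense, so this is the Baire category theorem in the complete
space \<open>S\<close>.\<close>

lemma avoid_countably_many_subspaces:
  fixes S :: "'a::banach set" and V :: "nat \<Rightarrow> 'a set"
  assumes S: "closed S" "subspace S"
    and V: "\<And>k. closed (V k)" "\<And>k. subspace (V k)" "\<And>k. \<not> S \<subseteq> V k"
  shows "\<exists>x\<in>S. \<forall>k. x \<notin> V k"
proof -
  have "top_of_set S closure_of \<Inter> (range (\<lambda>k. S - V k)) = topspace (top_of_set S)"
  proof (rule Baire_category)
    show "completely_metrizable_space (top_of_set S) \<or> locally_compact_space (top_of_set S) \<and> regular_space (top_of_set S)"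
      using S(1)
      by (intro disjI1 completely_metrizable_space_closedin[OF completely_metrizable_space_euclidean])
        simp
  next
    fix T assume "T \<in> range (\<lambda>k. S - V k)"
    then obtain k where T: "T = S - V k" by blast
    have "openin (top_of_set S) T"
      unfolding T using V(1) by (metis Diff_eq openin_open_Int open_Compl)
    moreover have "S \<subseteq> closure T"
    proof
      fix x assume x: "x \<in> S"
      show "x \<in> closure T"
      proof (cases "x \<in> V k")
        case False
        then show ?thesis using x T closure_subset[of T] by blast
      next
        case True
        obtain v where v: "v \<in> S" "v \<notin> V k" using V(3) by blast
        have in_T: "x + (1 / real (Suc n)) *\<^sub>R v \<in> T" for n
        proof -
          have "x + (1 / real (Suc n)) *\<^sub>R v \<in> S"
            using S(2) x v by (intro subspace_add subspace_scale)
          moreover have "x + (1 / real (Suc n)) *\<^sub>R v \<notin> V k"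
          proof
            assume "x + (1 / real (Suc n)) *\<^sub>R v \<in> V k"
            then have "real (Suc n) *\<^sub>R ((x + (1 / real (Suc n)) *\<^sub>R v) - x) \<in> V k"
              using V(2) True by (intro subspace_scale subspace_diff)
            then show False using v by simp
          qed
          ultimately show ?thesis by (simp add: T)
        qed
        have "(\<lambda>n. x + (1 / real (Suc n)) *\<^sub>R v) \<longlonglongrightarrow> x + 0 *\<^sub>R v"
          by (intro tendsto_intros LIMSEQ_Suc[OF lim_1_over_n])
        then show ?thesis
          unfolding closure_sequential using in_T
          by (intro exI[of _ "\<lambda>n. x + (1 / real (Suc n)) *\<^sub>R v"]) simp
      qed
    qed
    ultimately show "openin (top_of_set S) T \<and> top_of_set S closure_of T = topspace (top_of_set S)"
      by (auto simp: closure_of_subtopology T Int_absorb1)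
  qed auto
  moreover have "0 \<in> S" using S(2) by (rule subspace_0)
  ultimately have "\<Inter> (range (\<lambda>k. S - V k)) \<noteq> {}"
    by (metis closure_of_empty empty_iff topspace_euclidean_subtopology)
  then show ?thesis by blast
qed

section \<open>A smooth equivalent norm\<close>

text \<open>For a convex function the second difference quotients along all lines through \<open>x\<close> tend to \<open>0\<close> exactly
when all two-sided directional derivatives at \<open>x\<close> exist.\<close>

definition smooth_at :: "('a::real_vector \<Rightarrow> real) \<Rightarrow> 'a \<Rightarrow> bool" where
  "smooth_at p x \<longleftrightarrow>
    (\<forall>v. ((\<lambda>s. (p (x + s *\<^sub>R v) + p (x - s *\<^sub>R v) - 2 * p x) / s) \<longlongrightarrow> 0) (at_right 0))"

lemma L2_set_zero_extend:
  "n \<le> m \<Longrightarrow> L2_set (\<lambda>k. if k < n then t k else 0) {..<m::nat} = L2_set t {..<n}"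
  unfolding L2_set_def
  by (intro arg_cong[where f=sqrt] sum.mono_neutral_cong_right) auto

lemma L2_square: "(L2_set t A)\<^sup>2 = (\<Sum>k\<in>A. (t k)\<^sup>2)"
  by (simp add: L2_set_def sum_nonneg)

text \<open>The norm of \<open>(w, t)\<close> in the \<open>l\<^sup>2\<close>-sum of \<open>X\<close> with a finite-dimensional Euclidean space, where
\<open>x = w + (\<Sum>k<n. t k *\<^sub>R z k)\<close>. Its infimum over all \<open>n\<close> and \<open>t\<close> is a quotient seminorm on \<open>X\<close>: shifting \<open>x\<close>
by a multiple of some \<open>z k\<close> can be absorbed in \<open>t\<close>, and there the norm is Euclidean.\<close>

definition penalised :: "(nat \<Rightarrow> 'a) \<Rightarrow> nat \<Rightarrow> (nat \<Rightarrow> real) \<Rightarrow> 'a::real_normed_vector \<Rightarrow> real" where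
  "penalised z n t x = norm (x - (\<Sum>k<n. t k *\<^sub>R z k), L2_set t {..<n})"

definition smoothed_norm :: "(nat \<Rightarrow> 'a) \<Rightarrow> 'a::real_normed_vector \<Rightarrow> real" where
  "smoothed_norm z x = (INF (n, t)\<in>UNIV. penalised z n t x)"

lemma penalised_extend:
  assumes "n \<le> m"
  shows "penalised z m (\<lambda>k. if k < n then t k else 0) x = penalised z n t x"
proof -
  have "(\<Sum>k<m. (if k < n then t k else 0) *\<^sub>R z k) = (\<Sum>k<n. t k *\<^sub>R z k)"
    using assms by (intro sum.mono_neutral_cong_right) auto
  then show ?thesis using assms by (simp add: penalised_def L2_set_zero_extend)
qed

lemma penalised_triangle:
  "penalised z n (\<lambda>k. t k + t' k) (x + y) \<le> penalised z n t x + penalised z n t' y"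
proof -
  have eq: "x + y - (\<Sum>k<n. (t k + t' k) *\<^sub>R z k)
      = (x - (\<Sum>k<n. t k *\<^sub>R z k)) + (y - (\<Sum>k<n. t' k *\<^sub>R z k))"
    by (simp add: scaleR_add_left sum.distrib)
  have "penalised z n (\<lambda>k. t k + t' k) (x + y)
      \<le> norm ((x - (\<Sum>k<n. t k *\<^sub>R z k)) + (y - (\<Sum>k<n. t' k *\<^sub>R z k)), L2_set t {..<n} + L2_set t' {..<n})"
    unfolding penalised_def eq norm_Pair
    by (intro real_sqrt_le_mono add_mono power_mono)
      (auto simp: L2_set_triangle_ineq)
  also have "\<dots> = norm ((x - (\<Sum>k<n. t k *\<^sub>R z k), L2_set t {..<n}) + (y - (\<Sum>k<n. t' k *\<^sub>R z k), L2_set t' {..<n}))"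
    by simp
  also have "\<dots> \<le> penalised z n t x + penalised z n t' y"
    unfolding penalised_def by (rule norm_triangle_ineq)
  finally show ?thesis .
qed

lemma penalised_scale: "penalised z n (\<lambda>k. c * t k) (c *\<^sub>R x) = \<bar>c\<bar> * penalised z n t x"
proof -
  have "c *\<^sub>R x - (\<Sum>k<n. (c * t k) *\<^sub>R z k) = c *\<^sub>R (x - (\<Sum>k<n. t k *\<^sub>R z k))"
    by (simp add: scaleR_diff_right scaleR_sum_right)
  then have "penalised z n (\<lambda>k. c * t k) (c *\<^sub>R x)
      = sqrt (c\<^sup>2 * ((norm (x - (\<Sum>k<n. t k *\<^sub>R z k)))\<^sup>2 + (\<Sum>k<n. (t k)\<^sup>2)))"
    by (simp add: penalised_def norm_Pair L2_set_def sum_nonneg power_mult_distrib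
        sum_distrib_left distrib_left)
  also have "\<dots> = \<bar>c\<bar> * penalised z n t x"
    by (simp add: penalised_def norm_Pair L2_set_def sum_nonneg real_sqrt_mult)
  finally show ?thesis .
qed

lemma penalised_nonneg: "0 \<le> penalised z n t x"
  by (simp add: penalised_def)

lemma smoothed_norm_le: "smoothed_norm z x \<le> penalised z n t x"
  unfolding smoothed_norm_def
  by (rule cINF_lower2[where x = "(n, t)"]) (auto intro!: bdd_belowI2[of _ 0] simp: penalised_nonneg)

lemma smoothed_norm_ge: "(\<And>n t. b \<le> penalised z n t x) \<Longrightarrow> b \<le> smoothed_norm z x"
  unfolding smoothed_norm_def by (rule cINF_greatest) auto

lemma smoothed_norm_nonneg: "0 \<le> smoothed_norm z x"
  by (rule smoothed_norm_ge) (rule penalised_nonneg)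

lemma smoothed_norm_triangle: "smoothed_norm z (x + y) \<le> smoothed_norm z x + smoothed_norm z y"
proof -
  have *: "smoothed_norm z (x + y) \<le> penalised z n t x + penalised z n' t' y" for n t n' t'
  proof -
    let ?m = "max n n'"
    have "smoothed_norm z (x + y)
        \<le> penalised z ?m (\<lambda>k. (if k < n then t k else 0) + (if k < n' then t' k else 0)) (x + y)"
      by (rule smoothed_norm_le)
    also have "\<dots> \<le> penalised z ?m (\<lambda>k. if k < n then t k else 0) x
        + penalised z ?m (\<lambda>k. if k < n' then t' k else 0) y"
      by (rule penalised_triangle)
    also have "\<dots> = penalised z n t x + penalised z n' t' y"
      by (simp add: penalised_extend)
    finally show ?thesis .
  qed
  have "smoothed_norm z (x + y) - penalised z n' t' y \<le> smoothed_norm z x" for n' t'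
    using * by (intro smoothed_norm_ge) (simp add: algebra_simps)
  then have "smoothed_norm z (x + y) - smoothed_norm z x \<le> smoothed_norm z y"
    by (intro smoothed_norm_ge) (simp add: algebra_simps)
  then show ?thesis by simp
qed

lemma smoothed_norm_scale_le: "smoothed_norm z (c *\<^sub>R x) \<le> \<bar>c\<bar> * smoothed_norm z x"
proof (cases "c = 0")
  case True
  have "smoothed_norm z (c *\<^sub>R x) \<le> penalised z 0 (\<lambda>_. 0) (c *\<^sub>R x)"
    by (rule smoothed_norm_le)
  then show ?thesis using True by (simp add: penalised_def zero_prod_def[symmetric])
next
  case False
  have "smoothed_norm z (c *\<^sub>R x) / \<bar>c\<bar> \<le> smoothed_norm z x"
  proof (rule smoothed_norm_ge)
    fix n t
    show "smoothed_norm z (c *\<^sub>R x) / \<bar>c\<bar> \<le> penalised z n t x"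
      using smoothed_norm_le[of z "c *\<^sub>R x" n "\<lambda>k. c * t k"] False
      by (simp add: penalised_scale field_simps)
  qed
  then show ?thesis using False by (simp add: field_simps)
qed

lemma smoothed_norm_scale: "smoothed_norm z (c *\<^sub>R x) = \<bar>c\<bar> * smoothed_norm z x"
proof (cases "c = 0")
  case True
  then show ?thesis
    using smoothed_norm_scale_le[of z 0 x] smoothed_norm_nonneg[of z "0 *\<^sub>R x"] by simp
next
  case False
  have "\<bar>c\<bar> * smoothed_norm z ((1/c) *\<^sub>R (c *\<^sub>R x)) \<le> \<bar>c\<bar> * (\<bar>1/c\<bar> * smoothed_norm z (c *\<^sub>R x))"
    by (intro mult_left_mono smoothed_norm_scale_le) simp
  then show ?thesis using False smoothed_norm_scale_le[of z c x] by simp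
qed

lemma smoothed_norm_le_norm: "smoothed_norm z x \<le> norm x"
  using smoothed_norm_le[of z x 0 "\<lambda>_. 0"] by (simp add: penalised_def norm_Pair)

text \<open>Decompositions with a small Euclidean part move \<open>x\<close> only a little, since
\<open>(\<Sum>k<n. \<bar>t k\<bar> * norm (z k))\<close> is at most \<open>2\<close> times the Euclidean norm of \<open>t\<close>.\<close>

lemma norm_le_smoothed_norm:
  assumes z: "\<And>k. norm (z k) \<le> (1/2) ^ k"
  shows "norm x \<le> 3 * smoothed_norm z x"
proof -
  have "norm x / 3 \<le> penalised z n t x" for n t
  proof -
    let ?y = "x - (\<Sum>k<n. t k *\<^sub>R z k)"
    have "norm (\<Sum>k<n. t k *\<^sub>R z k) \<le> (\<Sum>k<n. L2_set t {..<n} * (1/2) ^ k)"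
    proof (rule order_trans[OF norm_sum sum_mono])
      fix k assume "k \<in> {..<n}"
      then have "\<bar>t k\<bar> \<le> L2_set (\<lambda>k. \<bar>t k\<bar>) {..<n}"
        by (intro member_le_L2_set[of _ _ "\<lambda>k. \<bar>t k\<bar>"]) auto
      then have "\<bar>t k\<bar> \<le> L2_set t {..<n}" by (simp add: L2_set_def)
      then show "norm (t k *\<^sub>R z k) \<le> L2_set t {..<n} * (1/2) ^ k"
        using z[of k] by (simp add: mult_mono)
    qed
    also have "\<dots> = L2_set t {..<n} * (\<Sum>k<n. (1/2) ^ k)"
      by (simp add: sum_distrib_left)
    also have "\<dots> \<le> L2_set t {..<n} * 2"
      by (intro mult_left_mono) (simp_all add: sum_gp_strict)
    finally have "norm x \<le> norm ?y + 2 * L2_set t {..<n}"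
      using norm_triangle_ineq[of ?y "\<Sum>k<n. t k *\<^sub>R z k"] by simp
    moreover have "norm ?y \<le> penalised z n t x" "L2_set t {..<n} \<le> penalised z n t x"
      using norm_fst_le[of ?y "L2_set t {..<n}"] norm_snd_le[of "L2_set t {..<n}" ?y]
      by (simp_all add: penalised_def)
    ultimately show ?thesis by simp
  qed
  then have "norm x / 3 \<le> smoothed_norm z x" by (rule smoothed_norm_ge)
  then show ?thesis by simp
qed

text \<open>Replacing \<open>t k\<close> by \<open>t k + s\<close> and by \<open>t k - s\<close> in a decomposition of \<open>x\<close> gives decompositions of
\<open>x + s *\<^sub>R z k\<close> and of \<open>x - s *\<^sub>R z k\<close> with the same remainder \<open>w\<close>; the squares of the penalties then
obey the parallelogram law of the Euclidean part. Passing to the infimum keeps the upper bound even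
when the infimum is not attained.\<close>

lemma smoothed_norm_parallelogram:
  "(smoothed_norm z (x + s *\<^sub>R z k))\<^sup>2 + (smoothed_norm z (x - s *\<^sub>R z k))\<^sup>2
     \<le> 2 * (smoothed_norm z x)\<^sup>2 + 2 * s\<^sup>2" (is "?A + ?B \<le> _")
proof -
  let ?Q = "(?A + ?B) / 2 - s\<^sup>2"
  have Q: "?Q \<le> (penalised z n t x)\<^sup>2" if "k < n" for n t
  proof -
    have shift: "(smoothed_norm z (x + r *\<^sub>R z k))\<^sup>2
        \<le> (penalised z n t x)\<^sup>2 + 2 * r * t k + r\<^sup>2" for r
    proof -
      let ?t = "t(k := t k + r)"
      have "(\<Sum>j<n. ?t j *\<^sub>R z j) = (\<Sum>j<n. t j *\<^sub>R z j + (if j = k then r *\<^sub>R z k else 0))"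
        by (intro sum.cong) (auto simp: scaleR_add_left)
      also have "\<dots> = (\<Sum>j<n. t j *\<^sub>R z j) + r *\<^sub>R z k"
        using that by (simp add: sum.distrib)
      finally have 1: "x + r *\<^sub>R z k - (\<Sum>j<n. ?t j *\<^sub>R z j) = x - (\<Sum>j<n. t j *\<^sub>R z j)"
        by simp
      have "(\<Sum>j<n. (?t j)\<^sup>2) = (\<Sum>j<n. (t j)\<^sup>2 + (if j = k then 2 * r * t k + r\<^sup>2 else 0))"
        by (intro sum.cong) (auto simp: power2_sum)
      also have "\<dots> = (\<Sum>j<n. (t j)\<^sup>2) + (2 * r * t k + r\<^sup>2)"
        using that by (simp add: sum.distrib)
      finally have 2: "(L2_set ?t {..<n})\<^sup>2 = (L2_set t {..<n})\<^sup>2 + 2 * r * t k + r\<^sup>2"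
        by (simp add: L2_square del: fun_upd_apply)
      have "(smoothed_norm z (x + r *\<^sub>R z k))\<^sup>2 \<le> (penalised z n ?t (x + r *\<^sub>R z k))\<^sup>2"
        by (intro power_mono smoothed_norm_le smoothed_norm_nonneg)
      also have "\<dots> = (norm (x - (\<Sum>j<n. t j *\<^sub>R z j)))\<^sup>2 + (L2_set ?t {..<n})\<^sup>2"
        unfolding penalised_def norm_Pair 1 by simp
      also have "\<dots> = (penalised z n t x)\<^sup>2 + 2 * r * t k + r\<^sup>2"
        unfolding penalised_def norm_Pair 2 by simp
      finally show ?thesis .
    qed
    show ?thesis using shift[of s] shift[of "-s"] by (simp add: field_simps)
  qed
  have Q': "?Q \<le> (penalised z n t x)\<^sup>2" for n t
    using Q[of "max n (Suc k)" "\<lambda>k. if k < n then t k else 0"] by (simp add: penalised_extend)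
  have "?Q \<le> (smoothed_norm z x)\<^sup>2"
  proof (cases "?Q \<le> 0")
    case True
    then show ?thesis by (meson order_trans zero_le_power2)
  next
    case False
    have "sqrt ?Q \<le> smoothed_norm z x"
    proof (rule smoothed_norm_ge)
      fix n t
      show "sqrt ?Q \<le> penalised z n t x"
        using real_sqrt_le_mono[OF Q'[of n t]] penalised_nonneg[of z n t x] by simp
    qed
    then have "(sqrt ?Q)\<^sup>2 \<le> (smoothed_norm z x)\<^sup>2"
      using False by (intro power_mono) auto
    then show ?thesis using False by simp
  qed
  then show ?thesis by (simp add: field_simps)
qed

lemma smoothed_norm_second_difference:
  assumes "smoothed_norm z x > 0"
  shows "smoothed_norm z (x + s *\<^sub>R z k) + smoothed_norm z (x - s *\<^sub>R z k) - 2 * smoothed_norm z x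
    \<le> s\<^sup>2 / smoothed_norm z x"
proof -
  let ?a = "smoothed_norm z (x + s *\<^sub>R z k)" and ?b = "smoothed_norm z (x - s *\<^sub>R z k)"
    and ?m = "smoothed_norm z x"
  have "(?a + ?b)\<^sup>2 \<le> 2 * (?a\<^sup>2 + ?b\<^sup>2)"
    using zero_le_power2[of "?a - ?b"] by (simp add: power2_eq_square algebra_simps)
  also have "\<dots> \<le> 4 * ?m\<^sup>2 + 4 * s\<^sup>2"
    using smoothed_norm_parallelogram[of z x s k] by simp
  also have "\<dots> \<le> 4 * ?m\<^sup>2 + 4 * s\<^sup>2 + (s\<^sup>2 / ?m)\<^sup>2"
    by simp
  also have "\<dots> = (2 * ?m + s\<^sup>2 / ?m)\<^sup>2"
    using assms by (simp add: power2_sum power_mult_distrib)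
  finally have "?a + ?b \<le> 2 * ?m + s\<^sup>2 / ?m"
    by (rule power2_le_imp_le) (use assms in simp)
  then show ?thesis by simp
qed

lemma is_norm_triangle: "is_norm N \<Longrightarrow> N (x + y) \<le> N x + N y"
  and is_norm_scale: "is_norm N \<Longrightarrow> N (c *\<^sub>R x) = \<bar>c\<bar> * N x"
  and is_norm_eq_0: "is_norm N \<Longrightarrow> N x = 0 \<longleftrightarrow> x = 0"
  by (auto simp: is_norm_def)

lemma is_norm_minus: "is_norm N \<Longrightarrow> N (- x) = N x"
  using is_norm_scale[of N "-1" x] by simp

lemma is_norm_nonneg: "is_norm N \<Longrightarrow> 0 \<le> N x"
  using is_norm_triangle[of N x "-x"] is_norm_minus[of N x] is_norm_eq_0[of N 0] by simp

lemma is_norm_pos: "is_norm N \<Longrightarrow> x \<noteq> 0 \<Longrightarrow> 0 < N x"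
  using is_norm_nonneg[of N x] is_norm_eq_0[of N x] by simp

lemma second_difference_nonneg:
  "is_norm N \<Longrightarrow> 0 \<le> N (x + v) + N (x - v) - 2 * N x"
  using is_norm_triangle[of N "x + v" "x - v"] is_norm_scale[of N 2 x] by (simp add: scaleR_2)

text \<open>In the directions of a dense sequence the second differences are quadratically small. A change of
the direction by \<open>w\<close> changes the second difference quotient by at most twice the norm of \<open>w\<close>, so the
quotients tend to \<open>0\<close> in all directions.\<close>

lemma smooth_equivalent_norm:
  fixes d :: "nat \<Rightarrow> 'a::real_normed_vector"
  assumes d: "\<And>x e. e > 0 \<Longrightarrow> \<exists>k. norm (d k - x) < e"
  shows "\<exists>M :: 'a \<Rightarrow> real. equivalent_norm M \<and> (\<forall>x. x \<noteq> 0 \<longrightarrow> smooth_at M x)"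
proof -
  define c where "c k = 1 / (2 ^ k * (1 + norm (d k)))" for k
  have c: "c k > 0" for k by (simp add: c_def add_pos_nonneg)
  define z where "z k = c k *\<^sub>R d k" for k
  have "norm (z k) \<le> (1/2) ^ k" for k
    using norm_ge_zero[of "d k"] by (simp add: z_def c_def power_one_over field_simps add_pos_nonneg)
  then have low: "norm x \<le> 3 * smoothed_norm z x" for x by (rule norm_le_smoothed_norm)
  have zero: "smoothed_norm z x = 0 \<longleftrightarrow> x = 0" for x
    using low[of x] smoothed_norm_le_norm[of z x] smoothed_norm_nonneg[of z x] by auto
  have nrm: "is_norm (smoothed_norm z)"
    by (simp add: is_norm_def zero smoothed_norm_triangle smoothed_norm_scale)
  have "equivalent_norm (smoothed_norm z)"
    unfolding equivalent_norm_def using nrm low smoothed_norm_le_norm[of z]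
    by (intro conjI exI[of _ "1/3"] exI[of _ 1]) (auto simp: mult.commute)
  moreover have "smooth_at (smoothed_norm z) x" if "x \<noteq> 0" for x
    unfolding smooth_at_def
  proof (intro allI tendstoI)
    fix v and \<epsilon> :: real assume "\<epsilon> > 0"
    let ?m = "smoothed_norm z" let ?D = "\<lambda>s v. ?m (x + s *\<^sub>R v) + ?m (x - s *\<^sub>R v) - 2 * ?m x"
    have mpos: "?m x > 0" using zero[of x] that smoothed_norm_nonneg[of z x] by simp
    obtain k where k: "norm (d k - v) < \<epsilon> / 4" using d[of "\<epsilon>/4" v] \<open>\<epsilon> > 0\<close> by auto
    \<comment> \<open>For \<open>s < \<delta>\<close> the quadratic term \<open>(s / c k)\<^sup>2 / ?m x\<close> stays below \<open>s * \<epsilon> / 2\<close>.\<close>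
    define \<delta> where "\<delta> = \<epsilon> / 2 * (c k)\<^sup>2 * ?m x"
    have "\<delta> > 0" using \<open>\<epsilon> > 0\<close> c[of k] mpos by (simp add: \<delta>_def)
    have "dist (?D s v / s) 0 < \<epsilon>" if s: "0 < s" "s < \<delta>" for s
    proof -
      have small: "?m (s *\<^sub>R (v - d k)) \<le> s * (\<epsilon> / 4)"
        using s k smoothed_norm_le_norm[of z "v - d k"]
        by (simp add: smoothed_norm_scale norm_minus_commute)
      have "?m (x + s *\<^sub>R v) \<le> ?m (x + s *\<^sub>R d k) + ?m (s *\<^sub>R (v - d k))"
        using smoothed_norm_triangle[of z "x + s *\<^sub>R d k" "s *\<^sub>R (v - d k)"]
        by (simp add: algebra_simps)
      moreover have "?m (x - s *\<^sub>R v) \<le> ?m (x - s *\<^sub>R d k) + ?m (s *\<^sub>R (v - d k))"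
        using smoothed_norm_triangle[of z "x - s *\<^sub>R d k" "(- s) *\<^sub>R (v - d k)"]
          smoothed_norm_scale[of z "-1" "s *\<^sub>R (v - d k)"]
        by (simp add: algebra_simps)
      moreover have "?D s (d k) \<le> (s / c k)\<^sup>2 / ?m x"
        using smoothed_norm_second_difference[OF mpos, of "s / c k" k] c[of k] by (simp add: z_def)
      ultimately have "?D s v \<le> (s / c k)\<^sup>2 / ?m x + s * (\<epsilon> / 2)"
        using small by simp
      also have "(s / c k)\<^sup>2 / ?m x < s * (\<epsilon> / 2)"
        using s c[of k] mpos by (simp add: \<delta>_def power2_eq_square field_simps)
      finally have "?D s v / s < \<epsilon>" using s by (simp add: field_simps)
      moreover have "0 \<le> ?D s v / s"
        using second_difference_nonneg[OF nrm, of x "s *\<^sub>R v"] s by simp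
      ultimately show ?thesis by (simp add: dist_real_def)
    qed
    then show "\<forall>\<^sub>F s in at_right 0. dist (?D s v / s) 0 < \<epsilon>"
      unfolding eventually_at_right_field using \<open>\<delta> > 0\<close> by blast
  qed
  ultimately show ?thesis by blast
qed

section \<open>Kinks of a norm and the functionals that cause them\<close>

lemma abs_kink:
  fixes a b :: real
  shows "((\<lambda>s. (\<bar>a + s * b\<bar> + \<bar>a - s * b\<bar> - 2 * \<bar>a\<bar>) / s) \<longlongrightarrow> (if a = 0 then 2 * \<bar>b\<bar> else 0)) (at_right 0)"
proof (rule tendsto_eventually, cases "a = 0")
  case True
  then show "\<forall>\<^sub>F s in at_right 0. (\<bar>a + s * b\<bar> + \<bar>a - s * b\<bar> - 2 * \<bar>a\<bar>) / s = (if a = 0 then 2 * \<bar>b\<bar> else 0)"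
    unfolding eventually_at_right_field by (intro exI[of _ 1]) (auto simp: abs_mult)
next
  case False
  define \<delta> where "\<delta> = \<bar>a\<bar> / (\<bar>b\<bar> + 1)"
  have "\<delta> > 0" using False by (simp add: \<delta>_def)
  moreover have "\<bar>a + s * b\<bar> + \<bar>a - s * b\<bar> - 2 * \<bar>a\<bar> = 0" if "0 < s" "s < \<delta>" for s
  proof -
    have "\<bar>s * b\<bar> \<le> s * (\<bar>b\<bar> + 1)" using that by (simp add: abs_mult)
    also have "\<dots> \<le> \<bar>a\<bar>" using that by (simp add: \<delta>_def field_simps)
    finally show ?thesis by linarith
  qed
  ultimately show "\<forall>\<^sub>F s in at_right 0. (\<bar>a + s * b\<bar> + \<bar>a - s * b\<bar> - 2 * \<bar>a\<bar>) / s = (if a = 0 then 2 * \<bar>b\<bar> else 0)"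
    unfolding eventually_at_right_field using False by (intro exI[of _ \<delta>]) auto
qed

lemma abs_second_difference_le:
  fixes a b s :: real
  assumes "s > 0"
  shows "\<bar>(\<bar>a + s * b\<bar> + \<bar>a - s * b\<bar> - 2 * \<bar>a\<bar>) / s\<bar> \<le> 2 * \<bar>b\<bar>"
proof -
  have "\<bar>\<bar>a + s * b\<bar> + \<bar>a - s * b\<bar> - 2 * \<bar>a\<bar>\<bar> \<le> 2 * \<bar>s * b\<bar>" by linarith
  then show ?thesis using assms by (simp add: abs_mult field_simps)
qed

text \<open>The functionals come in finite blocks \<open>F k\<close>, which will be the orbits of a finite group.\<close>

definition kinked :: "('a \<Rightarrow> real) \<Rightarrow> (nat \<Rightarrow> ('a \<Rightarrow> real) set) \<Rightarrow> 'a \<Rightarrow> real" where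
  "kinked M F x = M x + (\<Sum>k. \<Sum>f\<in>F k. \<bar>f x\<bar>)"

text \<open>The smooth part contributes nothing in the limit and \<open>\<bar>f\<bar>\<close> contributes only if \<open>f x = 0\<close>. The terms are
dominated by \<open>2 * \<bar>f v\<bar>\<close>, so Tannery's theorem permits taking the limit inside the series.\<close>

lemma kinked_second_difference:
  assumes M: "smooth_at M x"
    and fin: "\<And>k. finite (F k)" and lin: "\<And>k f. f \<in> F k \<Longrightarrow> linear f"
    and sm: "\<And>v. summable (\<lambda>k. \<Sum>f\<in>F k. \<bar>f v\<bar>)"
  shows "((\<lambda>s. (kinked M F (x + s *\<^sub>R v) + kinked M F (x - s *\<^sub>R v) - 2 * kinked M F x) / s)
      \<longlongrightarrow> (\<Sum>k. \<Sum>f\<in>F k. if f x = 0 then 2 * \<bar>f v\<bar> else 0)) (at_right 0)"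
proof -
  define a where "a k s = (\<Sum>f\<in>F k. (\<bar>f x + s * f v\<bar> + \<bar>f x - s * f v\<bar> - 2 * \<bar>f x\<bar>) / s)" for k s
  let ?b = "\<lambda>k. \<Sum>f\<in>F k. if f x = 0 then 2 * \<bar>f v\<bar> else 0"
  have "((\<lambda>s. suminf (\<lambda>k. a k s)) \<longlongrightarrow> suminf ?b) (at_right 0)"
  proof (rule tannerys_theorem[THEN conjunct2, THEN conjunct2])
    show "((\<lambda>s. a k s) \<longlongrightarrow> ?b k) (at_right 0)" for k
      unfolding a_def by (intro tendsto_sum abs_kink)
    have "\<bar>a k s\<bar> \<le> (\<Sum>f\<in>F k. 2 * \<bar>f v\<bar>)" if "s > 0" for k s
      unfolding a_def
      by (rule order_trans[OF sum_abs sum_mono]) (rule abs_second_difference_le[OF that])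
    then show "\<forall>\<^sub>F (k, s) in at_top \<times>\<^sub>F at_right 0. norm (a k s) \<le> (\<Sum>f\<in>F k. 2 * \<bar>f v\<bar>)"
      unfolding eventually_prod_filter
      by (intro exI[of _ "\<lambda>_. True"] exI[of _ "\<lambda>s. s > 0"]) (auto simp: eventually_at_right_less)
    show "summable (\<lambda>k. \<Sum>f\<in>F k. 2 * \<bar>f v\<bar>)"
      using summable_mult[OF sm[of v], of 2] by (simp add: sum_distrib_left)
  qed simp
  then have lim: "((\<lambda>s. (M (x + s *\<^sub>R v) + M (x - s *\<^sub>R v) - 2 * M x) / s + suminf (\<lambda>k. a k s))
      \<longlongrightarrow> 0 + suminf ?b) (at_right 0)"
    using M unfolding smooth_at_def by (intro tendsto_add) auto
  have eq: "(M (x + s *\<^sub>R v) + M (x - s *\<^sub>R v) - 2 * M x) / s + suminf (\<lambda>k. a k s)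
      = (kinked M F (x + s *\<^sub>R v) + kinked M F (x - s *\<^sub>R v) - 2 * kinked M F x) / s"
    if "s > 0" for s
  proof -
    have term_eq: "a k s = ((\<Sum>f\<in>F k. \<bar>f (x + s *\<^sub>R v)\<bar>) + (\<Sum>f\<in>F k. \<bar>f (x - s *\<^sub>R v)\<bar>)
        - 2 * (\<Sum>f\<in>F k. \<bar>f x\<bar>)) / s" for k
    proof -
      have "a k s = (\<Sum>f\<in>F k. (\<bar>f (x + s *\<^sub>R v)\<bar> + \<bar>f (x - s *\<^sub>R v)\<bar> - 2 * \<bar>f x\<bar>) / s)"
        unfolding a_def using lin by (intro sum.cong) (auto simp: linear_add linear_diff linear_scale)
      then show ?thesis
        by (simp add: sum_divide_distrib[symmetric] sum.distrib sum_subtractf sum_distrib_left)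
    qed
    have "(\<lambda>k. a k s) sums (((\<Sum>k. \<Sum>f\<in>F k. \<bar>f (x + s *\<^sub>R v)\<bar>)
        + (\<Sum>k. \<Sum>f\<in>F k. \<bar>f (x - s *\<^sub>R v)\<bar>) - 2 * (\<Sum>k. \<Sum>f\<in>F k. \<bar>f x\<bar>)) / s)"
      unfolding term_eq
      by (intro sums_divide sums_diff sums_add sums_mult summable_sums sm)
    then have "suminf (\<lambda>k. a k s) = ((\<Sum>k. \<Sum>f\<in>F k. \<bar>f (x + s *\<^sub>R v)\<bar>)
        + (\<Sum>k. \<Sum>f\<in>F k. \<bar>f (x - s *\<^sub>R v)\<bar>) - 2 * (\<Sum>k. \<Sum>f\<in>F k. \<bar>f x\<bar>)) / s"
      by (rule sums_unique[symmetric])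
    then show ?thesis
      unfolding kinked_def by (simp add: add_divide_distrib[symmetric] algebra_simps)
  qed
  have "\<forall>\<^sub>F s in at_right 0. (M (x + s *\<^sub>R v) + M (x - s *\<^sub>R v) - 2 * M x) / s + suminf (\<lambda>k. a k s)
      = (kinked M F (x + s *\<^sub>R v) + kinked M F (x - s *\<^sub>R v) - 2 * kinked M F x) / s"
    unfolding eventually_at_right_field using eq by (intro exI[of _ 1]) auto
  then show ?thesis using lim by (simp add: tendsto_cong)
qed

lemma proportional_if_kernel_subset:
  fixes f g :: "'a::real_vector \<Rightarrow> real"
  assumes "linear f" "linear g" "f e \<noteq> 0" and ker: "\<And>x. f x = 0 \<Longrightarrow> g x = 0"
  shows "g x = (g e / f e) * f x"
proof -
  have "f (x - (f x / f e) *\<^sub>R e) = 0"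
    using assms by (simp add: linear_diff linear_scale)
  then have "g (x - (f x / f e) *\<^sub>R e) = 0" by (rule ker)
  then show ?thesis using assms by (simp add: linear_diff linear_scale)
qed

text \<open>At a point \<open>x\<close> of the kernel of \<open>f\<close> at which no other functional vanishes, the second differences see
\<open>\<bar>f\<bar>\<close> alone. As \<open>T\<close> is an isometry, the functionals \<open>g\<close> that vanish at \<open>T x\<close> satisfy
\<open>(\<Sum>g. \<bar>g (T v)\<bar>) = \<bar>f v\<bar>\<close>; so each \<open>g \<circ> T\<close> is a multiple of \<open>f\<close>, and pairwise independence leaves
exactly one such \<open>g\<close>.\<close>

lemma kink_functional_transport:
  fixes M :: "'a::banach \<Rightarrow> real"
  assumes M: "\<And>x. x \<noteq> 0 \<Longrightarrow> smooth_at M x"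
    and N: "is_norm (kinked M F)"
    and fin: "\<And>k. finite (F k)" and bl: "\<And>k f. f \<in> F k \<Longrightarrow> bounded_linear f"
    and nz: "\<And>k f. f \<in> F k \<Longrightarrow> \<exists>x. f x \<noteq> 0"
    and indep: "\<And>j k f g c. f \<in> F j \<Longrightarrow> g \<in> F k \<Longrightarrow> (\<And>x. g x = c * f x) \<Longrightarrow> k = j \<and> g = f"
    and sm: "\<And>v. summable (\<lambda>k. \<Sum>f\<in>F k. \<bar>f v\<bar>)"
    and T: "linear T" "surj T" "\<And>x. kinked M F (T x) = kinked M F x"
    and f: "f \<in> F k"
  shows "\<exists>j. \<exists>g\<in>F j. \<forall>x. \<bar>g (T x)\<bar> = \<bar>f x\<bar>"
proof -
  have lin: "linear g" if "g \<in> F j" for g j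
    using bl[OF that] by (rule bounded_linear.linear)
  obtain e where e: "f e \<noteq> 0" using nz[OF f] by blast
  show ?thesis
  proof (cases "\<exists>x. x \<noteq> 0 \<and> f x = 0")
    case False
    \<comment> \<open>The kernel of \<open>f\<close> is trivial, so the space is one-dimensional and \<open>T\<close> is a sign.\<close>
    have x: "x = (f x / f e) *\<^sub>R e" for x
    proof -
      have "f (x - (f x / f e) *\<^sub>R e) = 0"
        using lin[OF f] e by (simp add: linear_diff linear_scale)
      then have "x - (f x / f e) *\<^sub>R e = 0" using False by blast
      then show ?thesis by simp
    qed
    define l where "l = f (T e) / f e"
    have Te: "T e = l *\<^sub>R e" unfolding l_def by (rule x)
    have "e \<noteq> 0" using e linear_0[OF lin[OF f]] by auto
    then have "kinked M F e > 0" by (rule is_norm_pos[OF N])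
    moreover have "\<bar>l\<bar> * kinked M F e = kinked M F e"
      using T(3)[of e] is_norm_scale[OF N, of l e] Te by simp
    ultimately have l: "\<bar>l\<bar> = 1" by simp
    have "\<bar>f (T x)\<bar> = \<bar>f x\<bar>" for x
    proof -
      have "T x = (f x / f e) *\<^sub>R T e" by (subst x) (simp add: linear_scale[OF T(1)])
      then have "f (T x) = f x / f e * (l * f e)" by (simp add: Te linear_scale[OF lin[OF f]])
      then have "f (T x) = f x * l" using e by simp
      then show ?thesis using l by (simp add: abs_mult)
    qed
    then show ?thesis using f by blast
  next
    case True
    then obtain x0 where x0: "x0 \<noteq> 0" "f x0 = 0" by blast
    \<comment> \<open>The subspace \<open>{0}\<close> is avoided as well, because the norm is smooth only away from the origin.\<close>
    define VV where "VV = insert {0} ((\<lambda>g. {x. g x = 0}) ` ((\<Union>j. F j) - {f}))"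
    have "countable VV" unfolding VV_def
      by (intro countable_insert countable_image countable_Diff countable_UN) (auto intro: countable_finite fin)
    define V where "V = from_nat_into VV"
    have V: "range V = VV"
      unfolding V_def using \<open>countable VV\<close> by (intro range_from_nat_into) (simp_all add: VV_def)
    have closed_ker: "closed {x. g x = 0}" and sub_ker: "subspace {x. g x = 0}" if "g \<in> F j" for g j
      using bl[OF that] lin[OF that]
      by (auto intro!: closed_Collect_eq linear_continuous_on continuous_on_const
          simp: subspace_def linear_0 linear_add linear_scale)
    have "\<exists>x\<in>{x. f x = 0}. \<forall>i. x \<notin> V i"
    proof (rule avoid_countably_many_subspaces[OF closed_ker[OF f] sub_ker[OF f]])
      fix i
      have "V i \<in> VV" using V by blast
      then consider "V i = {0}" | g j where "g \<in> F j" "g \<noteq> f" "V i = {x. g x = 0}"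
        unfolding VV_def by blast
      then have "closed (V i) \<and> subspace (V i) \<and> \<not> {x. f x = 0} \<subseteq> V i"
      proof cases
        case 1
        then show ?thesis using x0 by (auto simp: subspace_single_0)
      next
        case 2
        have "\<not> {x. f x = 0} \<subseteq> {x. g x = 0}"
        proof
          assume "{x. f x = 0} \<subseteq> {x. g x = 0}"
          then have "g x = (g e / f e) * f x" for x
            by (intro proportional_if_kernel_subset lin[OF f] lin[OF 2(1)] e) auto
          then show False using indep[OF f 2(1), of "g e / f e"] 2(2) by blast
        qed
        then show ?thesis using closed_ker[OF 2(1)] sub_ker[OF 2(1)] 2(3) by simp
      qed
      then show "closed (V i)" "subspace (V i)" "\<not> {x. f x = 0} \<subseteq> V i" by auto
    qed
    then obtain x where fx: "f x = 0" and "\<And>i. x \<notin> V i" by blast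
    then have notin: "x \<notin> A" if "A \<in> VV" for A using V that by (metis rangeE)
    have xnz: "x \<noteq> 0" using notin[of "{0}"] by (simp add: VV_def)
    have gx: "g x \<noteq> 0" if "g \<in> F j" "g \<noteq> f" for g j
    proof -
      have "{x. g x = 0} \<in> VV" using that unfolding VV_def by blast
      then show ?thesis using notin[of "{x. g x = 0}"] by simp
    qed
    have Txnz: "T x \<noteq> 0"
      using T(3)[of x] is_norm_pos[OF N xnz] is_norm_eq_0[OF N, of "T x"] by auto
    define K where "K y v j = (\<Sum>g\<in>F j. if g y = 0 then 2 * \<bar>g v\<bar> else 0)" for y v j
    have Kx: "suminf (K x v) = 2 * \<bar>f v\<bar>" for v
    proof -
      have "K x v j = (if j = k then 2 * \<bar>f v\<bar> else 0)" for j
      proof (cases "j = k")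
        case True
        have "K x v j = (\<Sum>g\<in>F k. if g = f then 2 * \<bar>f v\<bar> else 0)"
          unfolding K_def True using gx fx by (intro sum.cong) auto
        then show ?thesis using True f fin by simp
      next
        case False
        then have "g \<noteq> f" if "g \<in> F j" for g using indep[OF f, of f j 1] that by auto
        then have "K x v j = (\<Sum>g\<in>F j. 0)"
          unfolding K_def using gx by (intro sum.cong) auto
        then show ?thesis using False by simp
      qed
      then show ?thesis using suminf_finite[of "{k}" "K x v"] by auto
    qed
    have KT: "suminf (K (T x) (T v)) = 2 * \<bar>f v\<bar>" for v
    proof -
      have "((\<lambda>s. (kinked M F (T x + s *\<^sub>R T v) + kinked M F (T x - s *\<^sub>R T v) - 2 * kinked M F (T x)) / s)
          \<longlongrightarrow> suminf (K (T x) (T v))) (at_right 0)"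
        unfolding K_def by (rule kinked_second_difference[OF M[OF Txnz] fin lin sm])
      moreover have "T x + s *\<^sub>R T v = T (x + s *\<^sub>R v)" "T x - s *\<^sub>R T v = T (x - s *\<^sub>R v)" for s
        using T(1) by (simp_all add: linear_add linear_diff linear_scale)
      ultimately have "((\<lambda>s. (kinked M F (x + s *\<^sub>R v) + kinked M F (x - s *\<^sub>R v) - 2 * kinked M F x) / s)
          \<longlongrightarrow> suminf (K (T x) (T v))) (at_right 0)"
        by (simp add: T(3))
      moreover have "((\<lambda>s. (kinked M F (x + s *\<^sub>R v) + kinked M F (x - s *\<^sub>R v) - 2 * kinked M F x) / s)
          \<longlongrightarrow> suminf (K x v)) (at_right 0)"
        unfolding K_def by (rule kinked_second_difference[OF M[OF xnz] fin lin sm])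
      ultimately have "suminf (K (T x) (T v)) = suminf (K x v)"
        by (rule tendsto_unique[OF trivial_limit_at_right_real])
      then show ?thesis by (simp add: Kx)
    qed
    have K_nonneg: "0 \<le> K y v j" for y v j unfolding K_def by (intro sum_nonneg) auto
    have K_sm: "summable (K y v)" for y v
    proof (rule summable_comparison_test)
      show "summable (\<lambda>k. 2 * (\<Sum>f\<in>F k. \<bar>f v\<bar>))" using sm by (intro summable_mult)
      have "K y v j \<le> 2 * (\<Sum>f\<in>F j. \<bar>f v\<bar>)" for j
        unfolding K_def sum_distrib_left by (intro sum_mono) auto
      then show "\<exists>n0. \<forall>n\<ge>n0. norm (K y v n) \<le> 2 * (\<Sum>f\<in>F n. \<bar>f v\<bar>)"
        using K_nonneg by auto
    qed
    have dom: "\<bar>g (T v)\<bar> \<le> \<bar>f v\<bar>" if g: "g \<in> F j" "g (T x) = 0" for g j v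
    proof -
      have "2 * \<bar>g (T v)\<bar> \<le> K (T x) (T v) j"
        unfolding K_def using member_le_sum[OF g(1), of "\<lambda>g. if g (T x) = 0 then 2 * \<bar>g (T v)\<bar> else 0"] g fin
        by simp
      also have "\<dots> \<le> suminf (K (T x) (T v))"
        using sum_le_suminf[OF K_sm, of "{j}" "T x" "T v"] K_nonneg by simp
      finally show ?thesis using KT by simp
    qed
    have multiple: "\<exists>c. c \<noteq> 0 \<and> (\<forall>v. g (T v) = c * f v)" if g: "g \<in> F j" "g (T x) = 0" for g j
    proof -
      have "linear (\<lambda>v. g (T v))"
        using linear_compose[OF T(1) lin[OF g(1)]] by (simp add: o_def)
      moreover have "g (T v) = 0" if "f v = 0" for v using dom[OF g, of v] that by simp
      ultimately have *: "g (T v) = (g (T e) / f e) * f v" for v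
        by (intro proportional_if_kernel_subset[OF lin[OF f] _ e])
      obtain y where "g y \<noteq> 0" using nz[OF g(1)] by blast
      then obtain v where "g (T v) \<noteq> 0" using T(2) by (metis surjD)
      then have "g (T e) / f e \<noteq> 0" using *[of v] by auto
      then show ?thesis using * by blast
    qed
    have "\<exists>g j. g \<in> F j \<and> g (T x) = 0"
    proof (rule ccontr)
      assume no: "\<nexists>g j. g \<in> F j \<and> g (T x) = 0"
      have "K (T x) (T e) = (\<lambda>_. 0)"
        unfolding K_def using no by (intro ext sum.neutral) auto
      then show False using KT[of e] e by simp
    qed
    then obtain g j where g: "g \<in> F j" "g (T x) = 0" by blast
    have uniq: "i = j \<and> h = g" if h: "h \<in> F i" "h (T x) = 0" for h i
    proof -
      obtain c where c: "c \<noteq> 0" "\<And>v. g (T v) = c * f v" using multiple[OF g] by blast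
      obtain c' where c': "\<And>v. h (T v) = c' * f v" using multiple[OF h] by blast
      have "h y = (c' / c) * g y" for y
      proof -
        obtain v where "y = T v" using T(2) by (metis surjD)
        then show ?thesis using c c' by simp
      qed
      then show ?thesis using indep[OF g(1) h(1)] by blast
    qed
    have "\<bar>g (T v)\<bar> = \<bar>f v\<bar>" for v
    proof -
      have "K (T x) (T v) i = (if i = j then 2 * \<bar>g (T v)\<bar> else 0)" for i
      proof (cases "i = j")
        case True
        have "K (T x) (T v) i = (\<Sum>h\<in>F j. if h = g then 2 * \<bar>g (T v)\<bar> else 0)"
          unfolding K_def True
        proof (rule sum.cong[OF refl])
          fix h assume "h \<in> F j"
          then have "h (T x) = 0 \<longleftrightarrow> h = g" using uniq[of h j] g(2) by blast
          then show "(if h (T x) = 0 then 2 * \<bar>h (T v)\<bar> else 0) = (if h = g then 2 * \<bar>g (T v)\<bar> else 0)"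
            by simp
        qed
        then show ?thesis using True g fin by simp
      next
        case False
        have "K (T x) (T v) i = (\<Sum>h\<in>F i. 0)"
          unfolding K_def
        proof (rule sum.cong[OF refl])
          fix h assume "h \<in> F i"
          then have "h (T x) \<noteq> 0" using uniq[of h i] \<open>i \<noteq> j\<close> by blast
          then show "(if h (T x) = 0 then 2 * \<bar>h (T v)\<bar> else 0) = 0" by simp
        qed
        then show ?thesis using False by simp
      qed
      then have "suminf (K (T x) (T v)) = 2 * \<bar>g (T v)\<bar>"
        using suminf_finite[of "{j}" "K (T x) (T v)"] by auto
      then show ?thesis using KT by simp
    qed
    then show ?thesis using g by blast
  qed
qed

section \<open>Isometries that preserve orbits of functionals\<close>

lemma equivalent_norm_dominates:
  assumes "equivalent_norm M" "bounded_linear f"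
  shows "\<exists>K. \<forall>x. \<bar>f x\<bar> \<le> K * M x"
proof -
  obtain c where c: "c > 0" "\<And>x. c * norm x \<le> M x"
    using assms(1) unfolding equivalent_norm_def by blast
  obtain K where K: "K > 0" "\<And>x. \<bar>f x\<bar> \<le> norm x * K"
    using bounded_linear.pos_bounded[OF assms(2)] by auto
  have "\<bar>f x\<bar> \<le> (K / c) * M x" for x
  proof -
    have "norm x * K \<le> (M x / c) * K"
      using c(2)[of x] c(1) K(1) by (intro mult_right_mono) (auto simp: field_simps)
    then show ?thesis using K(2)[of x] by (simp add: mult.commute)
  qed
  then show ?thesis by blast
qed

text \<open>The scaled functional has dual norm at most \<open>1\<close>, and the point \<open>z\<close> witnesses that its dual norm is at
least \<open>1/2\<close>.\<close>

lemma normalise_functional: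
  assumes M: "equivalent_norm M" and f: "bounded_linear f" and nz: "f e \<noteq> (0::real)"
  shows "\<exists>a>0. (\<forall>x. a * \<bar>f x\<bar> \<le> M x) \<and> (\<exists>z. z \<noteq> 0 \<and> M z \<le> 2 * a * \<bar>f z\<bar>)"
proof -
  have nrm: "is_norm M" using M by (simp add: equivalent_norm_def)
  obtain K where K: "\<And>x. \<bar>f x\<bar> \<le> K * M x" using equivalent_norm_dominates[OF M f] by blast
  define s where "s = (SUP x\<in>-{0}. \<bar>f x\<bar> / M x)"
  have "e \<noteq> 0" using nz linear_0[OF bounded_linear.linear[OF f]] by auto
  have bdd: "bdd_above ((\<lambda>x. \<bar>f x\<bar> / M x) ` (-{0}))"
    by (rule bdd_aboveI2[of _ _ K]) (use K is_norm_pos[OF nrm] in \<open>auto simp: field_simps\<close>)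
  have le: "\<bar>f x\<bar> / M x \<le> s" if "x \<noteq> 0" for x
    unfolding s_def using bdd that by (intro cSUP_upper) auto
  have "0 < \<bar>f e\<bar> / M e" using nz is_norm_pos[OF nrm \<open>e \<noteq> 0\<close>] by simp
  then have s: "s > 0" using le[OF \<open>e \<noteq> 0\<close>] by linarith
  have "\<exists>z\<in>-{0}. s / 2 < \<bar>f z\<bar> / M z"
    using less_cSUP_iff[OF _ bdd, of "s / 2"] s \<open>e \<noteq> 0\<close> unfolding s_def by auto
  then obtain z where z: "z \<noteq> 0" "s / 2 < \<bar>f z\<bar> / M z" by blast
  have "(1 / s) * \<bar>f x\<bar> \<le> M x" for x
  proof (cases "x = 0")
    case True
    then show ?thesis using linear_0[OF bounded_linear.linear[OF f]] is_norm_nonneg[OF nrm] by simp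
  next
    case False
    then show ?thesis using le[of x] s is_norm_pos[OF nrm, of x] by (simp add: field_simps)
  qed
  moreover have "M z \<le> 2 * (1 / s) * \<bar>f z\<bar>"
    using z s is_norm_pos[OF nrm, of z] by (simp add: field_simps)
  ultimately show ?thesis using s z(1) by (intro exI[of _ "1 / s"]) auto
qed

locale bounded_action = group G for G (structure) +
  fixes \<rho> :: "'g \<Rightarrow> 'a::real_normed_vector \<Rightarrow> 'a"
  assumes fin: "finite (carrier G)"
    and bounded: "g \<in> carrier G \<Longrightarrow> bounded_linear (\<rho> g)"
    and act_mult: "g \<in> carrier G \<Longrightarrow> h \<in> carrier G \<Longrightarrow> \<rho> (g \<otimes> h) x = \<rho> g (\<rho> h x)"
    and act_one: "\<rho> \<one> x = x"
begin

lemma act_inv: "g \<in> carrier G \<Longrightarrow> \<rho> g (\<rho> (inv g) x) = x" "g \<in> carrier G \<Longrightarrow> \<rho> (inv g) (\<rho> g x) = x"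
  using act_mult[of g "inv g" x] act_mult[of "inv g" g x] by (simp_all add: act_one)

lemma act_eq_0: "g \<in> carrier G \<Longrightarrow> \<rho> g x = 0 \<longleftrightarrow> x = 0"
  by (metis act_inv(2) bounded bounded_linear.linear linear_0 inv_closed)

lemma sum_translate: "h \<in> carrier G \<Longrightarrow> (\<Sum>g\<in>carrier G. \<phi> (g \<otimes> h)) = (\<Sum>g\<in>carrier G. \<phi> g)"
  by (rule sum.reindex_bij_witness[of _ "\<lambda>g. g \<otimes> inv h" "\<lambda>g. g \<otimes> h"])
    (auto simp: m_assoc)

lemma invariant_smooth_norm:
  fixes d :: "nat \<Rightarrow> 'a"
  assumes d: "\<And>x e. e > 0 \<Longrightarrow> \<exists>k. norm (d k - x) < e"
  obtains M where "equivalent_norm M" "\<And>x. x \<noteq> 0 \<Longrightarrow> smooth_at M x"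
    "\<And>g x. g \<in> carrier G \<Longrightarrow> M (\<rho> g x) = M x"
proof -
  obtain m :: "'a \<Rightarrow> real" where m: "equivalent_norm m" and sm: "\<And>x. x \<noteq> 0 \<Longrightarrow> smooth_at m x"
    using smooth_equivalent_norm[OF d] by blast
  have nrm: "is_norm m" using m by (simp add: equivalent_norm_def)
  obtain c C where c: "c > 0" "\<And>x. c * norm x \<le> m x" and C: "C > 0" "\<And>x. m x \<le> C * norm x"
    using m unfolding equivalent_norm_def by blast
  have lin: "linear (\<rho> g)" if "g \<in> carrier G" for g
    using bounded[OF that] by (rule bounded_linear.linear)
  define M where "M x = (\<Sum>g\<in>carrier G. m (\<rho> g x))" for x
  have ge: "m x \<le> M x" for x
    using member_le_sum[of \<one> "carrier G" "\<lambda>g. m (\<rho> g x)"] is_norm_nonneg[OF nrm] fin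
    by (simp add: M_def act_one)
  have "M x = 0 \<longleftrightarrow> x = 0" for x
    using sum_nonneg_eq_0_iff[OF fin, of "\<lambda>g. m (\<rho> g x)"] is_norm_nonneg[OF nrm]
    by (auto simp: M_def is_norm_eq_0[OF nrm] act_eq_0)
  moreover have "M (x + y) \<le> M x + M y" for x y
    unfolding M_def sum.distrib[symmetric]
    by (intro sum_mono) (simp add: linear_add[OF lin] is_norm_triangle[OF nrm])
  moreover have "M (r *\<^sub>R x) = \<bar>r\<bar> * M x" for r x
    unfolding M_def sum_distrib_left
    by (intro sum.cong) (simp_all add: linear_scale[OF lin] is_norm_scale[OF nrm])
  ultimately have "is_norm M" unfolding is_norm_def by simp
  moreover have "M x \<le> (1 + C * (\<Sum>g\<in>carrier G. onorm (\<rho> g))) * norm x" for x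
  proof -
    have "M x \<le> (\<Sum>g\<in>carrier G. C * (onorm (\<rho> g) * norm x))"
      unfolding M_def
      by (intro sum_mono order_trans[OF C(2)] mult_left_mono onorm bounded) (use C(1) in auto)
    also have "\<dots> = C * (\<Sum>g\<in>carrier G. onorm (\<rho> g)) * norm x"
      by (simp add: sum_distrib_left sum_distrib_right mult.assoc)
    also have "\<dots> \<le> (1 + C * (\<Sum>g\<in>carrier G. onorm (\<rho> g))) * norm x"
      by (intro mult_right_mono) auto
    finally show ?thesis .
  qed
  moreover have "0 < 1 + C * (\<Sum>g\<in>carrier G. onorm (\<rho> g))"
    using C(1) by (intro add_pos_nonneg mult_nonneg_nonneg sum_nonneg onorm_pos_le bounded) auto
  moreover have "c * norm x \<le> M x" for x using c(2)[of x] ge[of x] by linarith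
  ultimately have "equivalent_norm M" unfolding equivalent_norm_def using c(1) by blast
  moreover have "smooth_at M x" if "x \<noteq> 0" for x
    unfolding smooth_at_def
  proof
    fix v
    have "((\<lambda>s. \<Sum>g\<in>carrier G. (m (\<rho> g x + s *\<^sub>R \<rho> g v) + m (\<rho> g x - s *\<^sub>R \<rho> g v) - 2 * m (\<rho> g x)) / s)
        \<longlongrightarrow> (\<Sum>g\<in>carrier G. 0)) (at_right 0)"
    proof (rule tendsto_sum)
      fix g assume "g \<in> carrier G"
      then show "((\<lambda>s. (m (\<rho> g x + s *\<^sub>R \<rho> g v) + m (\<rho> g x - s *\<^sub>R \<rho> g v) - 2 * m (\<rho> g x)) / s)
          \<longlongrightarrow> 0) (at_right 0)"
        using sm[of "\<rho> g x"] that unfolding smooth_at_def by (simp add: act_eq_0)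
    qed
    moreover have "(\<Sum>g\<in>carrier G. (m (\<rho> g x + s *\<^sub>R \<rho> g v) + m (\<rho> g x - s *\<^sub>R \<rho> g v) - 2 * m (\<rho> g x)) / s)
        = (M (x + s *\<^sub>R v) + M (x - s *\<^sub>R v) - 2 * M x) / s" for s
    proof -
      have "M (x + s *\<^sub>R v) = (\<Sum>g\<in>carrier G. m (\<rho> g x + s *\<^sub>R \<rho> g v))"
        "M (x - s *\<^sub>R v) = (\<Sum>g\<in>carrier G. m (\<rho> g x - s *\<^sub>R \<rho> g v))"
        unfolding M_def
        by (intro sum.cong; simp add: linear_add[OF lin] linear_diff[OF lin] linear_scale[OF lin])+
      then show ?thesis
        by (simp add: M_def sum_divide_distrib[symmetric] sum.distrib sum_subtractf sum_distrib_left)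
    qed
    ultimately show "((\<lambda>s. (M (x + s *\<^sub>R v) + M (x - s *\<^sub>R v) - 2 * M x) / s) \<longlongrightarrow> 0) (at_right 0)"
      by simp
  qed
  moreover have "M (\<rho> h x) = M x" if "h \<in> carrier G" for h x
  proof -
    have "M (\<rho> h x) = (\<Sum>g\<in>carrier G. m (\<rho> (g \<otimes> h) x))"
      unfolding M_def using that by (intro sum.cong) (simp_all add: act_mult)
    also have "\<dots> = M x" unfolding M_def by (rule sum_translate[OF that])
    finally show ?thesis .
  qed
  ultimately show thesis by (rule that)
qed

end

text \<open>The members of \<open>B k\<close> are scaled by a common factor so that their dual norms with respect to \<open>M\<close> lie
between \<open>r k / 2\<close> and \<open>r k\<close>, with \<open>r k = (1/8) ^ k / (2 * |G|)\<close>. The factor \<open>1 / (2 * |G|)\<close> keeps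
\<open>M \<le> N \<le> 2 * M\<close>, so passing from \<open>M\<close> to \<open>N\<close> changes dual norms by a factor of at most \<open>2\<close>. The ratio
\<open>8\<close> exceeds the total loss \<open>2 * 2\<close>, so an isometry cannot move a functional to a different orbit.\<close>

lemma orbit_preserving_renorming:
  fixes \<rho> :: "'g \<Rightarrow> 'a::banach \<Rightarrow> 'a" and B :: "nat \<Rightarrow> ('a \<Rightarrow> real) set" and d :: "nat \<Rightarrow> 'a"
  assumes act: "bounded_action G \<rho>"
    and d: "\<And>x e. e > 0 \<Longrightarrow> \<exists>k. norm (d k - x) < (e::real)"
    and bl: "\<And>k f. f \<in> B k \<Longrightarrow> bounded_linear f"
    and nz: "\<And>k f. f \<in> B k \<Longrightarrow> \<exists>x. f x \<noteq> 0"
    and indep: "\<And>j k f g c. f \<in> B j \<Longrightarrow> g \<in> B k \<Longrightarrow> (\<And>x. g x = c * f x) \<Longrightarrow> k = j \<and> g = f"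
    and orbit: "\<And>k f. f \<in> B k \<Longrightarrow> B k = (\<lambda>g x. f (\<rho> g x)) ` carrier G"
  shows "\<exists>N. equivalent_norm N \<and> (\<forall>g\<in>carrier G. \<forall>x. N (\<rho> g x) = N x) \<and>
    (\<forall>T k f. linear T \<and> surj T \<and> (\<forall>x. N (T x) = N x) \<and> f \<in> B k
      \<longrightarrow> (\<exists>h\<in>B k. \<forall>x. \<bar>h (T x)\<bar> = \<bar>f x\<bar>))"
proof -
  interpret bounded_action G \<rho> by (rule act)
  obtain M where M: "equivalent_norm M" and smooth: "\<And>x. x \<noteq> 0 \<Longrightarrow> smooth_at M x"
    and inv: "\<And>g x. g \<in> carrier G \<Longrightarrow> M (\<rho> g x) = M x"
    using invariant_smooth_norm[of d] d by metis
  have nrm: "is_norm M" using M by (simp add: equivalent_norm_def)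
  define c where "c = real (card (carrier G))"
  have c: "c > 0" unfolding c_def using fin by (simp add: card_gt_0_iff) (use one_closed in blast)
  have finB: "finite (B k)" and cardB: "real (card (B k)) \<le> c" for k
  proof -
    have "finite (B k) \<and> card (B k) \<le> card (carrier G)"
    proof (cases "B k = {}")
      case False
      then obtain f where "f \<in> B k" by blast
      then have "B k = (\<lambda>g x. f (\<rho> g x)) ` carrier G" by (rule orbit)
      then show ?thesis using fin card_image_le[OF fin] by (metis finite_imageI)
    qed simp
    then show "finite (B k)" "real (card (B k)) \<le> c" by (auto simp: c_def)
  qed
  have "\<exists>a>0. \<forall>f\<in>B k. (\<forall>x. a * \<bar>f x\<bar> \<le> M x) \<and> (\<exists>z. z \<noteq> 0 \<and> M z \<le> 2 * a * \<bar>f z\<bar>)" for k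
  proof (cases "B k = {}")
    case True
    then show ?thesis by (auto intro: exI[of _ 1])
  next
    case False
    then obtain f0 where f0: "f0 \<in> B k" by blast
    obtain e where "f0 e \<noteq> 0" using nz[OF f0] by blast
    then obtain a z where a: "a > 0" "\<And>x. a * \<bar>f0 x\<bar> \<le> M x" and z: "z \<noteq> 0" "M z \<le> 2 * a * \<bar>f0 z\<bar>"
      using normalise_functional[OF M bl[OF f0]] by blast
    have "(\<forall>x. a * \<bar>f x\<bar> \<le> M x) \<and> (\<exists>z. z \<noteq> 0 \<and> M z \<le> 2 * a * \<bar>f z\<bar>)" if fB: "f \<in> B k" for f
    proof -
      obtain g where g: "g \<in> carrier G" "f = (\<lambda>x. f0 (\<rho> g x))"
        using fB orbit[OF f0] by (auto simp: image_iff)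
      have "a * \<bar>f x\<bar> \<le> M x" for x using a(2)[of "\<rho> g x"] g inv by simp
      moreover have "\<rho> (inv\<^bsub>G\<^esub> g) z \<noteq> 0" using z(1) g(1) by (simp add: act_eq_0)
      moreover have "M (\<rho> (inv\<^bsub>G\<^esub> g) z) \<le> 2 * a * \<bar>f (\<rho> (inv\<^bsub>G\<^esub> g) z)\<bar>"
        using z(2) g by (simp add: inv act_inv)
      ultimately show ?thesis by blast
    qed
    then show ?thesis using a(1) by blast
  qed
  then obtain a where a: "\<And>k. a k > 0" "\<And>k f x. f \<in> B k \<Longrightarrow> a k * \<bar>f x\<bar> \<le> M x"
    and wit: "\<And>k f. f \<in> B k \<Longrightarrow> \<exists>z. z \<noteq> 0 \<and> M z \<le> 2 * a k * \<bar>f z\<bar>"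
    by metis
  define r where "r k = (1/8) ^ k / (2 * c)" for k :: nat
  define w where "w k = r k * a k" for k
  have r: "r k > 0" for k using c by (simp add: r_def)
  have w: "w k > 0" for k using r a(1) by (simp add: w_def)
  define F where "F k = (\<lambda>f x. w k * f x) ` B k" for k
  have sumF: "(\<Sum>h\<in>F k. \<bar>h x\<bar>) = (\<Sum>f\<in>B k. w k * \<bar>f x\<bar>)" for k x
  proof -
    have "inj_on (\<lambda>f x. w k * f x) (B k)"
    proof (rule inj_onI)
      fix f g assume "(\<lambda>x. w k * f x) = (\<lambda>x. w k * g x)"
      then have "w k * f x = w k * g x" for x by meson
      then show "f = g" using w[of k] by auto
    qed
    then show ?thesis unfolding F_def using w[of k] by (simp add: sum.reindex abs_mult)
  qed
  define S where "S k x = (\<Sum>h\<in>F k. \<bar>h x\<bar>)" for k x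
  have wM: "w k * \<bar>f x\<bar> \<le> r k * M x" if "f \<in> B k" for k f x
    using mult_left_mono[OF a(2)[OF that, of x], of "r k"] r[of k] by (simp add: w_def)
  have S_nonneg: "0 \<le> S k x" for k x unfolding S_def by (intro sum_nonneg) auto
  have S_le: "S k x \<le> M x / 2 * (1/8) ^ k" for k x
  proof -
    have "S k x \<le> real (card (B k)) * (r k * M x)"
      unfolding S_def sumF using wM by (intro sum_bounded_above)
    also have "\<dots> \<le> c * (r k * M x)"
      using cardB r[of k] is_norm_nonneg[OF nrm, of x] by (intro mult_right_mono) auto
    finally show ?thesis using c by (simp add: r_def mult.commute)
  qed
  have geo: "(\<lambda>k. M x / 2 * (1/8) ^ k) sums (M x / 2 * (1 / (1 - 1/8)))" for x
    by (intro sums_mult geometric_sums) simp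
  have S_sm: "summable (\<lambda>k. S k x)" for x
    by (rule summable_comparison_test'[OF sums_summable[OF geo[of x]], of 0])
      (use S_le S_nonneg in simp)
  have Ssum_le: "(\<Sum>k. S k x) \<le> M x" for x
  proof -
    have "(\<Sum>k. S k x) \<le> M x / 2 * (1 / (1 - 1/8))"
      using suminf_le[OF S_le S_sm sums_summable[OF geo]] sums_unique[OF geo] by metis
    then show ?thesis using is_norm_nonneg[OF nrm, of x] by simp
  qed
  have Ssum_nonneg: "0 \<le> (\<Sum>k. S k x)" for x by (intro suminf_nonneg S_sm S_nonneg)
  define N where "N = kinked M F"
  have N: "N x = M x + (\<Sum>k. S k x)" for x by (simp add: N_def kinked_def S_def)
  have MN: "M x \<le> N x" and NM: "N x \<le> 2 * M x" for x
    using Ssum_le[of x] Ssum_nonneg[of x] by (simp_all add: N)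
  have blF: "bounded_linear h" if h: "h \<in> F k" for h k
    using h bl by (auto simp: F_def intro: bounded_linear_const_mult)
  have linF: "linear h" if "h \<in> F k" for h k using blF[OF that] by (rule bounded_linear.linear)
  have nrmN: "is_norm N"
    unfolding is_norm_def
  proof (intro conjI allI)
    fix x y :: 'a and t :: real
    show "N x = 0 \<longleftrightarrow> x = 0"
      using MN[of x] NM[of x] is_norm_eq_0[OF nrm, of x] is_norm_nonneg[OF nrm, of x] by auto
    have "S k (x + y) \<le> S k x + S k y" for k
      unfolding S_def sum.distrib[symmetric]
      by (intro sum_mono) (simp add: linear_add[OF linF] abs_triangle_ineq)
    then have "(\<Sum>k. S k (x + y)) \<le> (\<Sum>k. S k x + S k y)"
      by (intro suminf_le S_sm summable_add) auto
    also have "\<dots> = (\<Sum>k. S k x) + (\<Sum>k. S k y)" by (intro suminf_add[symmetric] S_sm)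
    finally show "N (x + y) \<le> N x + N y"
      using is_norm_triangle[OF nrm, of x y] by (simp add: N)
    have "S k (t *\<^sub>R x) = \<bar>t\<bar> * S k x" for k
      unfolding S_def sum_distrib_left
      by (intro sum.cong) (simp_all add: linear_scale[OF linF] abs_mult)
    then show "N (t *\<^sub>R x) = \<bar>t\<bar> * N x"
      by (simp add: N is_norm_scale[OF nrm] suminf_mult[OF S_sm] distrib_left)
  qed
  obtain b C where bC: "b > 0" "C > 0" "\<And>x. b * norm x \<le> M x" "\<And>x. M x \<le> C * norm x"
    using M unfolding equivalent_norm_def by blast
  have "b * norm x \<le> N x \<and> N x \<le> (2 * C) * norm x" for x
    using bC(3,4)[of x] MN[of x] NM[of x] by (intro conjI) linarith+
  then have eqN: "equivalent_norm N"
    unfolding equivalent_norm_def using nrmN bC(1,2) by (meson mult_pos_pos zero_less_numeral)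
  have invN: "N (\<rho> g x) = N x" if g: "g \<in> carrier G" for g x
  proof -
    have "S k (\<rho> g x) = S k x" for k
    proof -
      let ?t = "\<lambda>f y. f (\<rho> g y)"
      have "?t f \<in> B k" if f: "f \<in> B k" for f
        using orbit[OF f] g by blast
      moreover have "inj_on ?t (B k)"
      proof (rule inj_onI)
        fix f h assume "(\<lambda>y. f (\<rho> g y)) = (\<lambda>y. h (\<rho> g y))"
        then have "f (\<rho> g (\<rho> (inv\<^bsub>G\<^esub> g) y)) = h (\<rho> g (\<rho> (inv\<^bsub>G\<^esub> g) y))" for y by meson
        then show "f = h" using g by (auto simp: act_inv)
      qed
      ultimately have img: "?t ` B k = B k" "inj_on ?t (B k)"
        using endo_inj_surj[OF finB, of ?t] by blast+
      have "(\<Sum>f\<in>B k. w k * \<bar>f x\<bar>) = (\<Sum>f\<in>?t ` B k. w k * \<bar>f x\<bar>)" by (simp only: img(1))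
      also have "\<dots> = (\<Sum>f\<in>B k. w k * \<bar>f (\<rho> g x)\<bar>)" by (simp add: sum.reindex[OF img(2)])
      finally show ?thesis by (simp add: S_def sumF)
    qed
    then show ?thesis using g by (simp add: N inv)
  qed
  have transport: "\<exists>j. \<exists>h\<in>B j. \<forall>x. w j * \<bar>h (T x)\<bar> = w k * \<bar>f x\<bar>"
    if T: "linear T" "surj T" "\<And>x. N (T x) = N x" and f: "f \<in> B k" for T k f
  proof -
    have "\<exists>j. \<exists>h\<in>F j. \<forall>x. \<bar>h (T x)\<bar> = \<bar>w k * f x\<bar>"
    proof (rule kink_functional_transport[OF smooth _ _ blF])
      show "is_norm (kinked M F)" using nrmN by (simp add: N_def)
      show "finite (F k)" for k using finB by (simp add: F_def)
      show "\<exists>x. h x \<noteq> 0" if "h \<in> F k" for h k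
        using that nz w[of k] unfolding F_def by fastforce
      show "k = j \<and> g = f" if fg: "f \<in> F j" "g \<in> F k" "\<And>x. g x = t * f x" for j k f g t
      proof -
        obtain f' g' where f': "f' \<in> B j" "f = (\<lambda>x. w j * f' x)"
          and g': "g' \<in> B k" "g = (\<lambda>x. w k * g' x)"
          using fg(1,2) unfolding F_def by blast
        have "g' x = (t * w j / w k) * f' x" for x
          using fg(3)[of x] f'(2) g'(2) w[of k] by (simp add: field_simps)
        then have "k = j \<and> g' = f'" by (rule indep[OF f'(1) g'(1)])
        then show ?thesis using f' g' by blast
      qed
      show "summable (\<lambda>k. \<Sum>h\<in>F k. \<bar>h v\<bar>)" for v using S_sm by (simp add: S_def)
      show "linear T" "surj T" by fact+
      show "kinked M F (T x) = kinked M F x" for x using T(3) by (simp add: N_def)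
      show "(\<lambda>x. w k * f x) \<in> F k" using f by (simp add: F_def)
    qed auto
    then obtain j h where "h \<in> F j" "\<And>x. \<bar>h (T x)\<bar> = \<bar>w k * f x\<bar>" by blast
    moreover then obtain h' where "h' \<in> B j" "h = (\<lambda>x. w j * h' x)" unfolding F_def by blast
    ultimately show ?thesis by (auto simp: abs_mult abs_of_pos[OF w] intro!: exI[of _ j] bexI[of _ h'])
  qed
  have level: "k \<ge> j"
    if T: "\<And>x. N (T x) = N x" and f: "f \<in> B k" and h: "h \<in> B j"
      and eq: "\<And>x. w j * \<bar>h (T x)\<bar> = w k * \<bar>f x\<bar>" for T j k f h
  proof -
    obtain z where z: "z \<noteq> 0" "M z \<le> 2 * a k * \<bar>f z\<bar>" using wit[OF f] by blast
    have Mz: "M z > 0" by (rule is_norm_pos[OF nrm z(1)])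
    have "r k * M z \<le> 2 * (w k * \<bar>f z\<bar>)"
      using mult_left_mono[OF z(2), of "r k"] r[of k] by (simp add: w_def algebra_simps)
    also have "w k * \<bar>f z\<bar> = w j * \<bar>h (T z)\<bar>" by (simp add: eq)
    also have "\<dots> \<le> r j * M (T z)" by (rule wM[OF h])
    also have "\<dots> \<le> r j * (2 * M z)"
      using MN[of "T z"] NM[of z] T[of z] r[of j] by (intro mult_left_mono) auto
    finally have "r k * M z \<le> (4 * r j) * M z" by simp
    then have "r k \<le> 4 * r j" using Mz by simp
    then have *: "(1/8) ^ k \<le> 4 * (1/8::real) ^ j" using c by (simp add: r_def field_simps)
    show "k \<ge> j"
    proof (rule ccontr)
      assume "\<not> k \<ge> j"
      then have "(1/8::real) ^ j \<le> (1/8) ^ Suc k" by (intro power_decreasing) auto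
      then have "8 * (1/8::real) ^ j \<le> (1/8) ^ k" by simp
      then show False using * zero_less_power[of "1/8::real" j] by linarith
    qed
  qed
  have "\<exists>h\<in>B k. \<forall>x. \<bar>h (T x)\<bar> = \<bar>f x\<bar>"
    if T: "linear T" "surj T" "\<And>x. N (T x) = N x" and f: "f \<in> B k" for T k f
  proof -
    obtain j h where h: "h \<in> B j" and eq: "\<And>x. w j * \<bar>h (T x)\<bar> = w k * \<bar>f x\<bar>"
      using transport[OF T f] by blast
    have "inj T"
      using T(3) is_norm_eq_0[OF nrmN] by (metis T(1) linear_injective_0)
    then have TT: "T (inv_into UNIV T x) = x" for x using T(2) by (simp add: surj_f_inv_f)
    have "N (inv_into UNIV T x) = N x" for x using T(3)[of "inv_into UNIV T x"] by (simp add: TT)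
    then have "j \<ge> k"
      by (rule level[OF _ h f, of "inv_into UNIV T"]) (simp add: eq[symmetric] TT)
    moreover have "k \<ge> j" by (rule level[OF T(3) f h eq])
    ultimately have "k = j" by simp
    then have "\<bar>h (T x)\<bar> = \<bar>f x\<bar>" for x using eq[of x] w[of k] by simp
    then show ?thesis using h \<open>k = j\<close> by blast
  qed
  then show ?thesis using eqN invN by blast
qed

section \<open>A family of functionals that determines the group\<close>

lemma abs_eq_imp_sign:
  fixes f h :: "'a::real_vector \<Rightarrow> real"
  assumes "linear f" "linear h" and eq: "\<And>x. \<bar>h x\<bar> = \<bar>f x\<bar>"
  shows "\<exists>s\<in>{1, -1}. \<forall>x. h x = s * f x"
proof (cases "\<exists>e. f e \<noteq> 0")
  case True
  then obtain e where e: "f e \<noteq> 0" by blast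
  have "f x = 0 \<Longrightarrow> h x = 0" for x using eq[of x] by simp
  then have h: "h x = (h e / f e) * f x" for x
    by (rule proportional_if_kernel_subset[OF assms(1,2) e])
  have "h e = f e \<or> h e = - f e" using eq[of e] by (simp add: abs_eq_iff)
  then have "h e / f e \<in> {1, -1}" using e by auto
  then show ?thesis using h by blast
next
  case False
  then show ?thesis using eq by force
qed

text \<open>The vectors \<open>e g\<close> span the copy of the regular representation and the \<open>y k\<close> vanish on it. Taking \<open>y 0 = 0\<close> makes the orbit of \<open>u \<one>\<close> one of the orbits of the functionals
\<open>u \<one> + y k\<close>.\<close>

locale group_coordinates = group G for G (structure) +
  fixes e :: "'g \<Rightarrow> 'a::banach" and u :: "'g \<Rightarrow> 'a \<Rightarrow> real" and y :: "nat \<Rightarrow> 'a \<Rightarrow> real"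
    and wt :: "'g \<Rightarrow> real"
  assumes fin: "finite (carrier G)"
    and u_bl: "g \<in> carrier G \<Longrightarrow> bounded_linear (u g)"
    and y_bl: "bounded_linear (y k)"
    and u_e: "g \<in> carrier G \<Longrightarrow> h \<in> carrier G \<Longrightarrow> u g (e h) = (if g = h then 1 else 0)"
    and y_e: "h \<in> carrier G \<Longrightarrow> y k (e h) = 0"
    and y_0: "y 0 x = 0"
    and separating: "(\<And>g. g \<in> carrier G \<Longrightarrow> u g x = 0) \<Longrightarrow> (\<And>k. y k x = 0) \<Longrightarrow> x = 0"
    and wt_inj: "inj_on wt (carrier G)" and wt_pos: "g \<in> carrier G \<Longrightarrow> wt g > 0"
begin

lemma u_lin: "g \<in> carrier G \<Longrightarrow> linear (u g)" and y_lin: "linear (y k)"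
  using u_bl y_bl by (simp_all add: bounded_linear.linear)

text \<open>\<open>e h\<close> goes to \<open>e (g \<otimes> h)\<close>, and the common kernel of the functionals \<open>u h\<close> is fixed pointwise.\<close>

definition act :: "'g \<Rightarrow> 'a \<Rightarrow> 'a" where
  "act g x = x + (\<Sum>h\<in>carrier G. u h x *\<^sub>R (e (g \<otimes> h) - e h))"

definition weighted :: "'g \<Rightarrow> 'a \<Rightarrow> real" where
  "weighted a x = (\<Sum>h\<in>carrier G. wt (a \<otimes> h) * u h x)"

text \<open>Keeping only the first functional on each line through the origin makes the remaining ones pairwise
non-proportional.\<close>

definition fresh :: "nat \<Rightarrow> bool" where
  "fresh k \<longleftrightarrow> (\<exists>x. y k x \<noteq> 0) \<and> (\<forall>j<k. \<nexists>c. \<forall>x. y k x = c * y j x)"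

text \<open>The orbit of \<open>u \<one> + y k\<close> has the even index \<open>2 * k\<close> and the singleton orbit of \<open>y k\<close> the odd index
\<open>2 * k + 1\<close>. The index \<open>1\<close> is free because \<open>y 0\<close> is never fresh, and receives the orbit of the weighted
sum of coordinates; for the trivial group that sum is proportional to \<open>u \<one>\<close> and has to be left out.\<close>

definition family :: "nat \<Rightarrow> ('a \<Rightarrow> real) set" where
  "family n = {f.
     (\<exists>k. n = 2 * k \<and> (k = 0 \<or> fresh k) \<and> (\<exists>a\<in>carrier G. f = (\<lambda>x. u a x + y k x))) \<or>
     (\<exists>k. n = 2 * k + 1 \<and> fresh k \<and> f = y k) \<or>
     (n = 1 \<and> carrier G \<noteq> {\<one>} \<and> (\<exists>a\<in>carrier G. f = weighted a))}"

lemma family_cases: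
  assumes "f \<in> family n"
  obtains (shifted) k a where "n = 2 * k" "k = 0 \<or> fresh k" "a \<in> carrier G" "f = (\<lambda>x. u a x + y k x)"
  | (extra) k where "n = 2 * k + 1" "fresh k" "f = y k"
  | (weighted) a where "n = 1" "carrier G \<noteq> {\<one>}" "a \<in> carrier G" "f = weighted a"
  using assms unfolding family_def by blast

lemma fresh_nonzero: "fresh k \<Longrightarrow> k \<noteq> 0"
  using y_0 unfolding fresh_def by metis

lemma bounded_linear_act: "bounded_linear (act g)"
  unfolding act_def using u_bl
  by (intro bounded_linear_add bounded_linear_ident bounded_linear_sum
      bounded_linear_compose[OF bounded_linear_scaleR_left]) auto

lemma u_act:
  assumes k: "k \<in> carrier G" and g: "g \<in> carrier G"
  shows "u k (act g x) = u (inv g \<otimes> k) x"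
proof -
  have "u k (act g x) = u k x + (\<Sum>h\<in>carrier G. u h x * (u k (e (g \<otimes> h)) - u k (e h)))"
    unfolding act_def using u_lin[OF k]
    by (simp add: linear_add linear_sum linear_scale linear_diff)
  also have "(\<Sum>h\<in>carrier G. u h x * (u k (e (g \<otimes> h)) - u k (e h)))
      = (\<Sum>h\<in>carrier G. (if h = inv g \<otimes> k then u h x else 0) - (if h = k then u h x else 0))"
  proof (rule sum.cong[OF refl])
    fix h assume h: "h \<in> carrier G"
    have "k = g \<otimes> h \<longleftrightarrow> h = inv g \<otimes> k"
      using g h k by (metis inv_solve_left)
    then show "u h x * (u k (e (g \<otimes> h)) - u k (e h))
        = (if h = inv g \<otimes> k then u h x else 0) - (if h = k then u h x else 0)"
      using g h k by (auto simp: u_e)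
  qed
  also have "\<dots> = u (inv g \<otimes> k) x - u k x"
    using fin g k by (simp add: sum_subtractf)
  finally show ?thesis by simp
qed

lemma y_act: "g \<in> carrier G \<Longrightarrow> y k (act g x) = y k x"
  unfolding act_def using y_lin[of k]
  by (simp add: linear_add linear_sum linear_scale linear_diff y_e)

lemma cancel:
  assumes "g \<in> carrier G" "h \<in> carrier G"
  shows "g \<otimes> (inv g \<otimes> h) = h" "inv g \<otimes> (g \<otimes> h) = h"
  using assms by (simp_all add: m_assoc[symmetric])

lemma eq_by_coordinates:
  assumes "\<And>g. g \<in> carrier G \<Longrightarrow> u g v = u g w" "\<And>k. y k v = y k w"
  shows "v = w"
proof -
  have "v - w = 0"
    by (rule separating) (simp_all add: assms linear_diff[OF u_lin] linear_diff[OF y_lin])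
  then show ?thesis by simp
qed

lemma act_action: "bounded_action G act"
proof (intro bounded_action.intro bounded_action_axioms.intro)
  fix g h x assume gh: "g \<in> carrier G" "h \<in> carrier G"
  show "act (g \<otimes> h) x = act g (act h x)"
    by (rule eq_by_coordinates) (use gh in \<open>simp_all add: u_act y_act inv_mult_group m_assoc\<close>)
next
  fix x show "act \<one> x = x"
    by (rule eq_by_coordinates) (simp_all add: u_act y_act)
qed (rule is_group fin bounded_linear_act)+

lemma weighted_act:
  assumes "a \<in> carrier G" "g \<in> carrier G"
  shows "weighted a (act g x) = weighted (a \<otimes> g) x"
proof -
  have "weighted a (act g x) = (\<Sum>h\<in>carrier G. wt (a \<otimes> h) * u (inv g \<otimes> h) x)"
    unfolding weighted_def using assms by (intro sum.cong) (simp_all add: u_act)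
  also have "\<dots> = weighted (a \<otimes> g) x"
    unfolding weighted_def
    by (rule sum.reindex_bij_witness[of _ "\<lambda>h. g \<otimes> h" "\<lambda>h. inv g \<otimes> h"])
      (use assms in \<open>simp_all add: m_assoc cancel\<close>)
  finally show ?thesis .
qed

lemma weighted_e: "a \<in> carrier G \<Longrightarrow> h \<in> carrier G \<Longrightarrow> weighted a (e h) = wt (a \<otimes> h)"
proof -
  assume a: "a \<in> carrier G" and h: "h \<in> carrier G"
  have "weighted a (e h) = (\<Sum>k\<in>carrier G. if k = h then wt (a \<otimes> k) else 0)"
    unfolding weighted_def using h by (intro sum.cong) (simp_all add: u_e)
  then show ?thesis using h fin by simp
qed

lemma bounded_linear_weighted: "bounded_linear (weighted a)"
  unfolding weighted_def using u_bl
  by (intro bounded_linear_sum bounded_linear_const_mult) auto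

lemma family_bounded_linear: "f \<in> family n \<Longrightarrow> bounded_linear f"
  by (erule family_cases) (auto intro: bounded_linear_add u_bl y_bl bounded_linear_weighted)

lemma family_nonzero: "f \<in> family n \<Longrightarrow> \<exists>x. f x \<noteq> 0"
proof (erule family_cases)
  fix k a assume "a \<in> carrier G" "f = (\<lambda>x. u a x + y k x)"
  then have "f (e a) \<noteq> 0" by (simp add: u_e y_e)
  then show ?thesis by blast
next
  fix a assume "a \<in> carrier G" "f = weighted a"
  then have "f (e \<one>) \<noteq> 0" using wt_pos[of a] by (simp add: weighted_e)
  then show ?thesis by blast
qed (simp add: fresh_def)

lemma family_orbit:
  assumes f: "f \<in> family n"
  shows "family n = (\<lambda>g x. f (act g x)) ` carrier G"
  using f
proof (cases rule: family_cases)
  case (shifted k a)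
  have "family n = (\<lambda>b x. u b x + y k x) ` carrier G"
    unfolding family_def shifted(1) using shifted(2) by auto presburger+
  also have "\<dots> = (\<lambda>g x. f (act g x)) ` carrier G"
  proof (intro equalityI subsetI)
    fix h assume "h \<in> (\<lambda>b x. u b x + y k x) ` carrier G"
    then obtain b where b: "b \<in> carrier G" "h = (\<lambda>x. u b x + y k x)" by blast
    have "inv (a \<otimes> inv b) \<otimes> a = b" using b(1) shifted(3) by (simp add: inv_mult_group m_assoc)
    then have "h = (\<lambda>x. f (act (a \<otimes> inv b) x))"
      using b shifted by (simp add: u_act y_act)
    then show "h \<in> (\<lambda>g x. f (act g x)) ` carrier G" using b(1) shifted(3) by blast
  next
    fix h assume "h \<in> (\<lambda>g x. f (act g x)) ` carrier G"
    then obtain g where g: "g \<in> carrier G" "h = (\<lambda>x. f (act g x))" by blast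
    then have "h = (\<lambda>x. u (inv g \<otimes> a) x + y k x)" using shifted by (simp add: u_act y_act)
    then show "h \<in> (\<lambda>b x. u b x + y k x) ` carrier G" using g(1) shifted(3) by blast
  qed
  finally show ?thesis .
next
  case (extra k)
  then have "n \<noteq> 1" using fresh_nonzero by auto
  then have "family n = {y k}"
    unfolding family_def using extra by auto presburger+
  also have "\<dots> = (\<lambda>g x. f (act g x)) ` carrier G"
    using extra(3) by (auto simp: y_act image_iff intro!: bexI[of _ \<one>])
  finally show ?thesis .
next
  case (weighted a)
  have "family n = group_coordinates.weighted G u wt ` carrier G"
    unfolding family_def weighted(1) using weighted(2) fresh_nonzero by auto
  also have "\<dots> = (\<lambda>g x. f (act g x)) ` carrier G"
  proof (intro equalityI subsetI)
    fix h assume "h \<in> group_coordinates.weighted G u wt ` carrier G"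
    then obtain b where b: "b \<in> carrier G" "h = group_coordinates.weighted G u wt b" by blast
    have "h = (\<lambda>x. f (act (inv a \<otimes> b) x))"
      using b weighted by (simp add: weighted_act m_assoc[symmetric])
    then show "h \<in> (\<lambda>g x. f (act g x)) ` carrier G" using b(1) weighted(3) by blast
  next
    fix h assume "h \<in> (\<lambda>g x. f (act g x)) ` carrier G"
    then obtain g where g: "g \<in> carrier G" "h = (\<lambda>x. f (act g x))" by blast
    then have "h = group_coordinates.weighted G u wt (a \<otimes> g)"
      using weighted by (simp add: weighted_act)
    then show "h \<in> group_coordinates.weighted G u wt ` carrier G" using g(1) weighted(3) by blast
  qed
  finally show ?thesis .
qed

lemma fresh_proportional:
  assumes "fresh k" "fresh j" and eq: "\<And>x. y k x = c * y j x"
  shows "k = j"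
proof (rule ccontr)
  assume "k \<noteq> j"
  then consider "j < k" | "k < j" by linarith
  then show False
  proof cases
    case 1
    then show ?thesis using assms unfolding fresh_def by blast
  next
    case 2
    have "c \<noteq> 0" using assms(1) eq unfolding fresh_def by auto
    then have "y j x = (1 / c) * y k x" for x using eq by simp
    then show ?thesis using 2 assms(2) unfolding fresh_def by blast
  qed
qed

lemma exists_other:
  assumes "carrier G \<noteq> {\<one>}" "a \<in> carrier G"
  shows "\<exists>h\<in>carrier G. h \<noteq> a"
proof (rule ccontr)
  assume "\<not> (\<exists>h\<in>carrier G. h \<noteq> a)"
  then have single: "h = a" if "h \<in> carrier G" for h using that by blast
  have "carrier G \<subseteq> {\<one>}" using single single[OF one_closed] by blast
  then show False using assms(1) one_closed by blast
qed

lemma weighted_not_shifted: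
  assumes "carrier G \<noteq> {\<one>}" "a \<in> carrier G" "b \<in> carrier G"
  obtains h where "h \<in> carrier G" "u b (e h) + y k (e h) = 0" "weighted a (e h) > 0"
proof -
  obtain h where "h \<in> carrier G" "h \<noteq> b" using exists_other[OF assms(1,3)] by blast
  then show thesis using assms by (intro that[of h]) (simp_all add: u_e y_e weighted_e wt_pos)
qed

text \<open>The values at the vectors \<open>e h\<close> tell the three kinds of functionals apart: exactly one is non-zero, all
are zero, or all are positive and there are at least two. Within the first and the third kind they
give \<open>c = 1\<close> and the group element; fresh functionals \<open>y k\<close> are pairwise non-proportional by choice.\<close>

lemma family_independent:
  assumes f: "f \<in> family j" and g: "g \<in> family k" and eq: "\<And>x. g x = c * f x"
  shows "k = j \<and> g = f"
proof -
  have c: "c \<noteq> 0" using family_nonzero[OF g] eq by auto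
  from f show ?thesis
  proof (cases rule: family_cases)
    case F: (shifted i a)
    from g show ?thesis
    proof (cases rule: family_cases)
      case H: (shifted l b)
      have "1 = c * (if a = b then 1 else 0)"
        using eq[of "e b"] F H by (simp add: u_e y_e)
      then have ab: "a = b" "c = 1" by (auto split: if_splits)
      then have yy: "y l x = 1 * y i x" for x using eq[of x] F H by simp
      have "l = i"
      proof (cases "l = 0 \<or> i = 0")
        case True
        then have "\<not> fresh l \<or> \<not> fresh i" using fresh_nonzero by blast
        moreover have "(\<exists>x. y l x \<noteq> 0) \<longleftrightarrow> (\<exists>x. y i x \<noteq> 0)" using yy by simp
        ultimately show ?thesis using F(2) H(2) True y_0 unfolding fresh_def by metis
      next
        case False
        then show ?thesis using fresh_proportional[OF _ _ yy] F(2) H(2) by blast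
      qed
      then show ?thesis using ab F H by simp
    next
      case H: (extra l)
      show ?thesis using eq[of "e a"] c F H by (simp add: u_e y_e)
    next
      case H: (weighted b)
      obtain h where "h \<in> carrier G" "u a (e h) + y i (e h) = 0" "weighted b (e h) > 0"
        by (rule weighted_not_shifted[OF H(2,3) F(3)])
      then show ?thesis using eq[of "e h"] F H by simp
    qed
  next
    case F: (extra i)
    from g show ?thesis
    proof (cases rule: family_cases)
      case H: (shifted l b)
      show ?thesis using eq[of "e b"] F H by (simp add: u_e y_e)
    next
      case H: (extra l)
      then have "l = i" using fresh_proportional[of l i c] eq F by simp
      then show ?thesis using F H by simp
    next
      case H: (weighted b)
      show ?thesis using eq[of "e \<one>"] F H wt_pos[of b] by (simp add: y_e weighted_e)
    qed
  next
    case F: (weighted a)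
    from g show ?thesis
    proof (cases rule: family_cases)
      case H: (shifted l b)
      obtain h where "h \<in> carrier G" "u b (e h) + y l (e h) = 0" "weighted a (e h) > 0"
        by (rule weighted_not_shifted[OF F(2,3) H(3)])
      then show ?thesis using eq[of "e h"] c F H by simp
    next
      case H: (extra l)
      show ?thesis using eq[of "e \<one>"] c F H wt_pos[of a] by (simp add: y_e weighted_e)
    next
      case H: (weighted b)
      \<comment> \<open>The weighted sums in one orbit have the same coefficients in a different order.\<close>
      have total: "(\<Sum>h\<in>carrier G. weighted a (e h)) = (\<Sum>h\<in>carrier G. wt h)" if "a \<in> carrier G" for a
      proof -
        have "(\<Sum>h\<in>carrier G. weighted a (e h)) = (\<Sum>h\<in>carrier G. wt (a \<otimes> h))"
          using that by (intro sum.cong) (simp_all add: weighted_e)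
        also have "\<dots> = (\<Sum>h\<in>carrier G. wt h)"
          by (rule sum.reindex_bij_witness[of _ "\<lambda>h. inv a \<otimes> h" "\<lambda>h. a \<otimes> h"])
            (use that in \<open>simp_all add: cancel\<close>)
        finally show ?thesis .
      qed
      have "(\<Sum>h\<in>carrier G. weighted b (e h)) = c * (\<Sum>h\<in>carrier G. weighted a (e h))"
        using eq F H by (simp add: sum_distrib_left)
      moreover have "(\<Sum>h\<in>carrier G. wt h) > 0"
        using fin wt_pos one_closed by (intro sum_pos) auto
      ultimately have "c = 1" using total F(3) H(3) by simp
      then have "wt b = wt a" using eq[of "e \<one>"] F H by (simp add: weighted_e)
      then have "b = a" using wt_inj F(3) H(3) by (auto dest: inj_onD)
      then show ?thesis using F H by simp
    qed
  qed
qed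

lemma eq_by_fresh_coordinates:
  assumes "\<And>g. g \<in> carrier G \<Longrightarrow> u g v = u g w" "\<And>k. fresh k \<Longrightarrow> y k v = y k w"
  shows "v = w"
proof (rule eq_by_coordinates[OF assms(1)])
  fix k show "y k v = y k w"
  proof (induction k rule: less_induct)
    case (less k)
    show ?case
    proof (cases "fresh k")
      case False
      then consider "\<And>x. y k x = 0" | j c where "j < k" "\<And>x. y k x = c * y j x"
        unfolding fresh_def by blast
      then show ?thesis using less by cases simp_all
    qed (rule assms(2))
  qed
qed

definition preserving :: "('a \<Rightarrow> 'a) \<Rightarrow> bool" where
  "preserving T \<longleftrightarrow> (\<forall>n. \<forall>f\<in>family n. \<exists>h\<in>family n. \<forall>x. \<bar>h (T x)\<bar> = \<bar>f x\<bar>)"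

lemma preservingE:
  assumes "preserving T" "linear T" "f \<in> family n"
  obtains h s where "h \<in> family n" "s \<in> {1, -1}" "\<And>x. h (T x) = s * f x"
proof -
  obtain h where h: "h \<in> family n" "\<And>x. \<bar>h (T x)\<bar> = \<bar>f x\<bar>"
    using assms unfolding preserving_def by blast
  have lin: "linear (h \<circ> T)" "linear f"
    using linear_compose[OF assms(2) bounded_linear.linear[OF family_bounded_linear[OF h(1)]]]
      bounded_linear.linear[OF family_bounded_linear[OF assms(3)]] by blast+
  have "\<exists>s\<in>{1, -1}. \<forall>x. (h \<circ> T) x = s * f x"
    by (rule abs_eq_imp_sign[OF lin(2,1)]) (simp add: h(2))
  then obtain s where "s \<in> {1, -1}" "\<And>x. (h \<circ> T) x = s * f x" by blast
  then show thesis using that h(1) by simp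
qed

lemma shifted_mem: "a \<in> carrier G \<Longrightarrow> k = 0 \<or> fresh k \<Longrightarrow> (\<lambda>x. u a x + y k x) \<in> family (2 * k)"
  unfolding family_def by blast

lemma family_even:
  assumes "f \<in> family (2 * k)"
  obtains a where "a \<in> carrier G" "f = (\<lambda>x. u a x + y k x)"
  using assms
proof (cases rule: family_cases)
  case (shifted l a)
  then have "l = k" by simp
  then show thesis using shifted that by blast
next
  case (extra l)
  then show thesis by presburger
next
  case (weighted a)
  then show thesis by presburger
qed

lemma family_odd:
  assumes "f \<in> family (2 * k + 1)" "fresh k"
  shows "f = y k"
  using assms(1)
proof (cases rule: family_cases)
  case (shifted l a)
  then show ?thesis by presburger
next
  case (weighted a)
  then show ?thesis using fresh_nonzero[OF assms(2)] by simp
qed simp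

lemma family_1:
  assumes "f \<in> family 1"
  obtains a where "a \<in> carrier G" "f = weighted a"
  using assms
proof (cases rule: family_cases)
  case (shifted l a)
  then show thesis by presburger
next
  case (extra l)
  then show thesis using fresh_nonzero[of l] by simp
next
  case (weighted a)
  then show thesis using that by blast
qed

lemma preserving_coordinates:
  assumes T: "preserving T" "linear T" and g: "g \<in> carrier G"
  obtains b s where "b \<in> carrier G" "s \<in> {1, -1}" "\<And>x. u b (T x) = s * u g x"
proof -
  have "(\<lambda>x. u g x + y 0 x) \<in> family (2 * 0)" using g by (intro shifted_mem) simp_all
  then obtain h s where h: "h \<in> family (2 * 0)" "s \<in> {1, -1}" "\<And>x. h (T x) = s * (u g x + y 0 x)"
    by (rule preservingE[OF T]) blast
  obtain b where "b \<in> carrier G" "h = (\<lambda>x. u b x + y 0 x)" using family_even[OF h(1)] .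
  then show thesis using h by (intro that[of b s]) (simp_all add: y_0)
qed

text \<open>The map permutes the coordinates up to signs. Comparing coefficients in the fixed weighted sum, a
weight equals plus or minus the weight to which it is moved; as the weights are positive and distinct,
all signs are positive and the permutation is trivial.\<close>

lemma preserving_fixes_coordinates:
  assumes T: "preserving T" "linear T"
    and w: "\<And>x. weighted \<one> (T x) = weighted \<one> x" and g: "g \<in> carrier G"
  shows "u g (T x) = u g x"
proof -
  have "\<forall>g\<in>carrier G. \<exists>b s. b \<in> carrier G \<and> s \<in> {1, -1} \<and> (\<forall>x. u b (T x) = s * u g x)"
    using preserving_coordinates[OF T] by metis
  then obtain \<sigma> s where \<sigma>: "\<And>g. g \<in> carrier G \<Longrightarrow> \<sigma> g \<in> carrier G"
    and s: "\<And>g. g \<in> carrier G \<Longrightarrow> s g \<in> {1, -1::real}"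
    and u: "\<And>g x. g \<in> carrier G \<Longrightarrow> u (\<sigma> g) (T x) = s g * u g x"
    by metis
  have inj: "inj_on \<sigma> (carrier G)"
  proof (rule inj_onI)
    fix g h assume gh: "g \<in> carrier G" "h \<in> carrier G" "\<sigma> g = \<sigma> h"
    have "s g * u g (e g) = s h * u h (e g)" 
      using u[OF gh(1), of "e g"] u[OF gh(2), of "e g"] gh(3) by simp
    then have "s g = s h * (if h = g then 1 else 0)" using gh(1,2) by (simp add: u_e)
    moreover have "s g \<noteq> 0" using s[OF gh(1)] by auto
    ultimately show "g = h" by (cases "h = g") simp_all
  qed
  have img: "\<sigma> ` carrier G = carrier G"
    using \<sigma> inj by (intro endo_inj_surj fin) auto
  have weights: "wt h = s h * wt (\<sigma> h)" if h: "h \<in> carrier G" for h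
  proof -
    have "wt h = weighted \<one> (T (e h))" using h by (simp add: w weighted_e)
    also have "\<dots> = (\<Sum>k\<in>\<sigma> ` carrier G. wt k * u k (T (e h)))"
      unfolding weighted_def img by (intro sum.cong) simp_all
    also have "\<dots> = (\<Sum>k\<in>carrier G. wt (\<sigma> k) * u (\<sigma> k) (T (e h)))"
      by (simp add: sum.reindex[OF inj])
    also have "\<dots> = (\<Sum>k\<in>carrier G. if k = h then s k * wt (\<sigma> k) else 0)"
      using h by (intro sum.cong) (simp_all add: u u_e)
    finally show ?thesis using h fin by simp
  qed
  have "s g = 1"
    using s[OF g] weights[OF g] wt_pos[OF g] wt_pos[OF \<sigma>[OF g]] by auto
  moreover then have "\<sigma> g = g"
    using weights[OF g] wt_inj g \<sigma>[OF g] by (auto dest: inj_onD)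
  ultimately show ?thesis using u[OF g, of x] by simp
qed

text \<open>A fresh \<open>y k\<close> can only change its sign, and the value of \<open>u \<one> + y k\<close> at \<open>e \<one>\<close> shows that this functional
goes to itself with a positive sign. As \<open>u \<one>\<close> is fixed, so is \<open>y k\<close>.\<close>

lemma preserving_identity:
  assumes T: "preserving T" "linear T"
    and u: "\<And>g x. g \<in> carrier G \<Longrightarrow> u g (T x) = u g x"
  shows "T x = x"
proof (rule eq_by_fresh_coordinates[OF u])
  fix k assume k: "fresh k"
  have "y k \<in> family (2 * k + 1)" using k unfolding family_def by blast
  then obtain h t where h: "h \<in> family (2 * k + 1)" "\<And>x. h (T x) = t * y k x"
    by (rule preservingE[OF T]) blast
  then have t: "y k (T x) = t * y k x" for x using family_odd[OF h(1) k] by simp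
  have "(\<lambda>x. u \<one> x + y k x) \<in> family (2 * k)" using k by (intro shifted_mem) simp_all
  then obtain h' s where h': "h' \<in> family (2 * k)" "s \<in> {1, -1}"
      "\<And>x. h' (T x) = s * (u \<one> x + y k x)"
    by (rule preservingE[OF T]) blast
  obtain b where b: "b \<in> carrier G" "h' = (\<lambda>x. u b x + y k x)" using family_even[OF h'(1)] .
  have eq: "u b x + t * y k x = s * (u \<one> x + y k x)" for x
    using h'(3)[of x] b by (simp add: u t)
  have "u b (e \<one>) = s" using eq[of "e \<one>"] by (simp add: y_e u_e)
  then have "b = \<one>" "s = 1" using h'(2) b(1) by (auto simp: u_e split: if_splits)
  then show "y k (T x) = y k x" using eq[of x] by (simp add: t)
qed

text \<open>Composing \<open>T\<close> with a suitable sign and group element makes it fix the weighted sum, or \<open>u \<one>\<close> if the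
group is trivial; the composition is then the identity.\<close>

lemma preserving_linear_maps:
  assumes T: "linear T" and pres: "\<And>g s. g \<in> carrier G \<Longrightarrow> s \<in> {1, -1} \<Longrightarrow> preserving (\<lambda>x. s *\<^sub>R act g (T x))"
  obtains g s where "g \<in> carrier G" "s \<in> {1, -1}" "\<And>x. T x = s *\<^sub>R act g x"
proof -
  interpret A: bounded_action G act by (rule act_action)
  have act_lin: "linear (act g)" for g using bounded_linear_act by (rule bounded_linear.linear)
  have lin: "linear (\<lambda>x. s *\<^sub>R act g (T x))" for s :: real and g
    using linear_compose[OF T linear_compose[OF act_lin linear_scaleR]] by (simp add: o_def)
  have presT: "preserving T"
    using pres[of \<one> 1] by (simp add: A.act_one)
  have "\<exists>a\<in>carrier G. \<exists>s\<in>{1, -1}. \<forall>g\<in>carrier G. \<forall>x. u g (s *\<^sub>R act a (T x)) = u g x"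
  proof (cases "carrier G = {\<one>}")
    case True
    obtain b s where bs: "b \<in> carrier G" "s \<in> {1, -1}" "\<And>x. u b (T x) = s * u \<one> x"
      by (rule preserving_coordinates[OF presT T one_closed]) blast
    then have "u \<one> (s *\<^sub>R act \<one> (T x)) = u \<one> x" for x
      using True by (auto simp: A.act_one linear_scale[OF u_lin])
    then show ?thesis using True bs(2) by auto
  next
    case False
    then have "weighted \<one> \<in> family 1" unfolding family_def by blast
    then obtain h s where h: "h \<in> family 1" "s \<in> {1, -1}" "\<And>x. h (T x) = s * weighted \<one> x"
      by (rule preservingE[OF presT T]) blast
    obtain a where a: "a \<in> carrier G" "h = weighted a" using family_1[OF h(1)] .
    have "weighted \<one> (s *\<^sub>R act a (T x)) = weighted \<one> x" for x
      using a h(2) h(3)[of x] bounded_linear.linear[OF bounded_linear_weighted[of \<one>]]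
      by (auto simp: linear_scale weighted_act)
    then have "u g (s *\<^sub>R act a (T x)) = u g x" if "g \<in> carrier G" for g x
      using preserving_fixes_coordinates[OF pres[OF a(1) h(2)] lin] that by blast
    then show ?thesis using a(1) h(2) by blast
  qed
  then obtain a s where a: "a \<in> carrier G" and s: "s \<in> {1, -1}"
    and u: "\<And>g x. g \<in> carrier G \<Longrightarrow> u g (s *\<^sub>R act a (T x)) = u g x" by blast
  have id: "s *\<^sub>R act a (T x) = x" for x
    using preserving_identity[OF pres[OF a s] lin u] .
  have "T x = s *\<^sub>R act (inv a) x" for x
  proof -
    have "s *\<^sub>R act (inv a) x = s *\<^sub>R act (inv a) (s *\<^sub>R act a (T x))" by (simp only: id)
    also have "\<dots> = (s * s) *\<^sub>R T x"
      by (simp add: linear_scale[OF act_lin] A.act_inv a)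
    finally show ?thesis using s by auto
  qed
  then show thesis using a s by (intro that[of "inv a" s]) auto
qed

end

section \<open>Representability\<close>

theorem theorem12:
  fixes G :: "('g, 'm) monoid_scheme"
  assumes "group G" and "finite (carrier G)"
    and "separable_space (euclidean :: 'a::banach topology)"
    and "space_dim TYPE('a) \<ge> enat (card (carrier G))"
  shows "representable_in (sign_img \<times>\<times> G) TYPE('a)"
proof -
  interpret G: group G by (rule assms(1))
  obtain d :: "nat \<Rightarrow> 'a" where d: "\<And>x e. e > 0 \<Longrightarrow> \<exists>k. norm (d k - x) < e"
    using separable_space_dense_sequence[OF assms(3)] by blast
  obtain \<phi> :: "nat \<Rightarrow> 'a \<Rightarrow> real" where \<phi>: "\<And>k. bounded_linear (\<phi> k)"
    and sep: "\<And>x. (\<And>k. \<phi> k x = 0) \<Longrightarrow> x = 0"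
    using separating_sequence[OF d] by blast
  have "\<exists>(e :: 'g \<Rightarrow> 'a) u. (\<forall>g\<in>carrier G. bounded_linear (u g)) \<and>
      (\<forall>g\<in>carrier G. \<forall>h\<in>carrier G. u g (e h) = (if g = h then 1 else 0 :: real))"
    by (rule biorthogonal_system[OF \<phi> _ assms(2,4)]) (rule sep)
  then obtain e :: "'g \<Rightarrow> 'a" and u where u: "\<And>g. g \<in> carrier G \<Longrightarrow> bounded_linear (u g)"
    and ue: "\<And>g h. g \<in> carrier G \<Longrightarrow> h \<in> carrier G \<Longrightarrow> u g (e h) = (if g = h then 1 else 0 :: real)"
    by blast
  \<comment> \<open>The projection along the vectors \<open>e h\<close> onto the common kernel of the \<open>u h\<close>.\<close>
  define P where "P x = x - (\<Sum>h\<in>carrier G. u h x *\<^sub>R e h)" for x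
  have P: "bounded_linear P"
    unfolding P_def using u
    by (intro bounded_linear_sub bounded_linear_ident bounded_linear_sum
        bounded_linear_compose[OF bounded_linear_scaleR_left]) auto
  have Pe: "P (e g) = 0" if "g \<in> carrier G" for g
  proof -
    have "(\<Sum>h\<in>carrier G. u h (e g) *\<^sub>R e h) = (\<Sum>h\<in>carrier G. if h = g then e h else 0)"
      using that by (intro sum.cong) (simp_all add: ue)
    then show ?thesis using that assms(2) by (simp add: P_def)
  qed
  define y where "y k x = (case k of 0 \<Rightarrow> 0 | Suc j \<Rightarrow> \<phi> j (P x))" for k x
  have y: "bounded_linear (y k)" for k
    using bounded_linear_compose[OF \<phi> P] by (cases k) (simp_all add: y_def[abs_def])
  obtain w :: "'g \<Rightarrow> nat" where w: "inj_on w (carrier G)"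
    using finite_imp_inj_to_nat_seg[OF assms(2)] by blast
  interpret C: group_coordinates G e u y "\<lambda>g. 1 + real (w g)"
  proof (intro group_coordinates.intro group_coordinates_axioms.intro)
    show "inj_on (\<lambda>g. 1 + real (w g)) (carrier G)"
      using w by (auto simp: inj_on_def)
    show "y k (e h) = 0" if "h \<in> carrier G" for h k
      using Pe[OF that] linear_0[OF bounded_linear.linear[OF \<phi>]] by (cases k) (simp_all add: y_def)
    show "x = 0" if u0: "\<And>g. g \<in> carrier G \<Longrightarrow> u g x = 0" and y0: "\<And>k. y k x = 0" for x
    proof (rule sep)
      fix k
      have "P x = x" using u0 by (simp add: P_def)
      then show "\<phi> k x = 0" using y0[of "Suc k"] by (simp add: y_def)
    qed
  qed (simp_all add: assms G.is_group u ue y y_def add_pos_nonneg)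
  interpret A: bounded_action G C.act by (rule C.act_action)
  have act_lin: "linear (C.act g)" for g
    using C.bounded_linear_act by (rule bounded_linear.linear)
  have "\<exists>N. equivalent_norm N \<and> (\<forall>g\<in>carrier G. \<forall>x. N (C.act g x) = N x) \<and>
    (\<forall>T k f. linear T \<and> surj T \<and> (\<forall>x. N (T x) = N x) \<and> f \<in> C.family k
      \<longrightarrow> (\<exists>h\<in>C.family k. \<forall>x. \<bar>h (T x)\<bar> = \<bar>f x\<bar>))"
    by (rule orbit_preserving_renorming[OF C.act_action, where d = d])
      (rule d C.family_bounded_linear C.family_nonzero C.family_independent C.family_orbit,
        assumption+)+
  then obtain N :: "'a \<Rightarrow> real" where N: "equivalent_norm N"
    and inv: "\<And>g x. g \<in> carrier G \<Longrightarrow> N (C.act g x) = N x"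
    and orbits: "\<And>T k f. linear T \<Longrightarrow> surj T \<Longrightarrow> (\<forall>x. N (T x) = N x) \<Longrightarrow> f \<in> C.family k
      \<Longrightarrow> \<exists>h\<in>C.family k. \<forall>x. \<bar>h (T x)\<bar> = \<bar>f x\<bar>"
    by blast
  have nrm: "is_norm N" using N by (simp add: equivalent_norm_def)
  define \<Psi> where "\<Psi> = (\<lambda>(s :: int, g) x. real_of_int s *\<^sub>R C.act g x)"
  have isometry: "linear (\<lambda>x. s *\<^sub>R C.act g (T x)) \<and> surj (\<lambda>x. s *\<^sub>R C.act g (T x))
      \<and> (\<forall>x. N (s *\<^sub>R C.act g (T x)) = N x)"
    if s: "s \<in> {1, -1}" and g: "g \<in> carrier G"
      and T: "linear T" "surj T" "\<And>x. N (T x) = N x" for s g T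
  proof (intro conjI allI)
    show "linear (\<lambda>x. s *\<^sub>R C.act g (T x))"
      using linear_compose[OF T(1) linear_compose[OF act_lin linear_scaleR]] by (simp add: o_def)
    show "surj (\<lambda>x. s *\<^sub>R C.act g (T x))"
    proof (rule surjI)
      fix x
      show "s *\<^sub>R C.act g (T (inv_into UNIV T (s *\<^sub>R C.act (inv\<^bsub>G\<^esub> g) x))) = x"
        using s g by (auto simp: surj_f_inv_f[OF T(2)] linear_scale[OF act_lin] A.act_inv linear_neg[OF act_lin])
    qed
    show "N (s *\<^sub>R C.act g (T x)) = N x" for x
      using s g T(3)[of x] by (auto simp: is_norm_scale[OF nrm] is_norm_minus[OF nrm] inv)
  qed
  have "\<Psi> \<in> iso (sign_img \<times>\<times> G) (isometry_group N)"
    unfolding iso_iff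
  proof (intro conjI)
    have mem: "\<Psi> (s, g) \<in> carrier (isometry_group N)" if "s \<in> {1, -1}" "g \<in> carrier G" for s g
    proof -
      have "real_of_int s \<in> {1, -1}" using that(1) by auto
      then show ?thesis
        using isometry[of "real_of_int s" g "\<lambda>x. x"] that(2) linear_id surj_id
        by (simp add: isometry_group_def \<Psi>_def id_def)
    qed
    have mult: "\<Psi> (s * t, g \<otimes>\<^bsub>G\<^esub> h) = \<Psi> (s, g) \<circ> \<Psi> (t, h)"
      if "g \<in> carrier G" "h \<in> carrier G" for s t g h
      using that by (auto simp: \<Psi>_def A.act_mult linear_scale[OF act_lin])
    show "\<Psi> \<in> hom (sign_img \<times>\<times> G) (isometry_group N)"
    proof (rule homI)
      fix p assume "p \<in> carrier (sign_img \<times>\<times> G)"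
      then show "\<Psi> p \<in> carrier (isometry_group N)"
        using mem by (auto simp: sign_img_def DirProd_def)
    next
      fix p q assume "p \<in> carrier (sign_img \<times>\<times> G)" "q \<in> carrier (sign_img \<times>\<times> G)"
      then show "\<Psi> (p \<otimes>\<^bsub>sign_img \<times>\<times> G\<^esub> q) = \<Psi> p \<otimes>\<^bsub>isometry_group N\<^esub> \<Psi> q"
        using mult by (cases p; cases q) (simp add: sign_img_def DirProd_def isometry_group_def)
    qed
    show "\<Psi> ` carrier (sign_img \<times>\<times> G) = carrier (isometry_group N)"
    proof (intro equalityI subsetI)
      fix T assume "T \<in> \<Psi> ` carrier (sign_img \<times>\<times> G)"
      then show "T \<in> carrier (isometry_group N)"
        using mem by (auto simp: sign_img_def DirProd_def)
    next
      fix T assume "T \<in> carrier (isometry_group N)"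
      then have T: "linear T" "surj T" "\<And>x. N (T x) = N x"
        by (auto simp: isometry_group_def)
      have "C.preserving (\<lambda>x. s *\<^sub>R C.act g (T x))" if "g \<in> carrier G" "s \<in> {1, -1}" for g s
        unfolding C.preserving_def using isometry[OF that(2,1) T] orbits by blast
      then obtain g s where g: "g \<in> carrier G" and s: "s \<in> {1, -1}" and Tx: "\<And>x. T x = s *\<^sub>R C.act g x"
        using C.preserving_linear_maps[OF T(1)] by blast
      obtain t :: int where t: "t \<in> {1, -1}" "s = real_of_int t"
        using s by (metis insertCI insertE of_int_1 of_int_minus singletonD)
      have "T = \<Psi> (t, g)" using Tx t(2) by (auto simp: \<Psi>_def)
      then show "T \<in> \<Psi> ` carrier (sign_img \<times>\<times> G)"
        using t(1) g by (auto simp: sign_img_def DirProd_def)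
    qed
    show "inj_on \<Psi> (carrier (sign_img \<times>\<times> G))"
    proof (rule inj_onI, clarify)
      fix s g t h
      assume "(s, g) \<in> carrier (sign_img \<times>\<times> G)" "(t, h) \<in> carrier (sign_img \<times>\<times> G)"
        and eq: "\<Psi> (s, g) = \<Psi> (t, h)"
      then have g: "g \<in> carrier G" and h: "h \<in> carrier G" and s: "s \<in> {1, -1}"
        by (auto simp: sign_img_def DirProd_def)
      have "u g (\<Psi> (s, g) (e \<one>\<^bsub>G\<^esub>)) = u g (\<Psi> (t, h) (e \<one>\<^bsub>G\<^esub>))" by (simp only: eq)
      then have *: "s = (if inv\<^bsub>G\<^esub> h \<otimes>\<^bsub>G\<^esub> g = \<one>\<^bsub>G\<^esub> then t else 0)"
        using g h by (simp add: \<Psi>_def linear_scale[OF C.u_lin] C.u_act ue split: if_splits)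
      then have "inv\<^bsub>G\<^esub> h \<otimes>\<^bsub>G\<^esub> g = \<one>\<^bsub>G\<^esub>" using s by (auto split: if_splits)
      then have "g = h" using g h by (metis G.inv_equality G.inv_inv G.inv_closed)
      then show "s = t \<and> g = h" using * g by simp
    qed
  qed
  then have "sign_img \<times>\<times> G \<cong> isometry_group N" by (rule is_isoI)
  then have "isometry_group N \<cong> sign_img \<times>\<times> G"
    by (rule group.iso_sym[OF DirProd_group[OF sign_img_is_group assms(1)]])
  then show ?thesis unfolding representable_in_def using N by blast
qed

end
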